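(* Let $K\subset\mathbb{R}^n$ be a convex body, let $C=\frac12(K+(-K))$ be its central symmetral, and write its support function as $h_K=h_{\mathrm{odd}}+h_{\mathrm{even}}$ with $h_{\mathrm{even}}(u)=\frac{h_K(u)+h_K(-u)}2$ and $h_{\mathrm{odd}}(u)=\frac{h_K(u)-h_K(-u)}2$. For $t\in[-1,1]$ let $K_t=\frac{1+t}{2}K+\frac{1-t}{2}(-K)$. Then for every $k=1,\ldots,n$, $$W_{n-k}(K_t)=W_{n-k}(C)+\sum_{r=1}^{\lfloor k/2\rfloor}\binom{k}{2r}t^{2r}\,V\left(h_{\mathrm{even}}^{[k-2r]},h_{\mathrm{odd}}^{[2r]},1^{[n-k]}\right).$$ Consequently, with $\mathcal A_k(K)=W_{n-k}(C)-W_{n-k}(K)$, $$\mathcal A_k(K)=-\sum_{r=1}^{\lfloor k/2\rfloor}\binom{k}{2r}\,V\left(h_{\mathrm{even}}^{[k-2r]},h_{\mathrm{odd}}^{[2r]},1^{[n-k]}\right).$$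
   Context: A convex body in $\mathbb{R}^n$ is a compact convex set with non-empty interior; $h_K(u)=\max_{x\in K}\langle x,u\rangle$, $u\in\mathbb{S}^{n-1}$, is its support function; sums of bodies are Minkowski sums and $-K=\{-x:x\in K\}$. $B=B^n$ is the Euclidean unit ball. $V(K_1,\ldots,K_n)$ is the mixed volume, i.e. $V(K_1,\ldots,K_n)=\frac1{n!}\frac{\partial^n}{\partial t_1\cdots\partial t_n}\mathrm{Vol}_n(t_1K_1+\cdots+t_nK_n)|_{t=0}$, so $V(K,\ldots,K)=\mathrm{Vol}_n(K)$. A superscript $[r]$ means that the argument is repeated $r$ times. Quermassintegrals are $W_j(K)=V(K^{[n-j]},B^{[j]})$, $j=0,\ldots,n$. Identifying bodies with their support functions, mixed volume is extended multilinearly to linear combinations (formal differences) of support functions on $\mathbb{S}^{n-1}$; the function $1$ is the support function of $B^n$. *)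

theory Defs
  imports "HOL-Analysis.Analysis" "HOL-Library.Set_Algebras"
begin

text \<open>
  Minkowski sums are the operation \<open>+\<close> on sets from \<open>HOL-Library.Set_Algebras\<close>. Dilates and
  reflections are written as images: \<open>- K\<close> on sets would be the complement.
\<close>

definition convex_body :: "'a::euclidean_space set \<Rightarrow> bool" where
  "convex_body K \<longleftrightarrow> compact K \<and> convex K \<and> interior K \<noteq> {}"

definition support_fun :: "'a::euclidean_space set \<Rightarrow> 'a \<Rightarrow> real" where
  "support_fun K u = (SUP x\<in>K. x \<bullet> u)"

text \<open>
  \<open>Vol (t\<^sub>0 K\<^sub>0 + \<dots> + t\<^sub>m K\<^sub>m)\<close> is in general a polynomial only on nonnegative \<open>t\<^sub>i\<close> (for instance
  \<open>Vol (t K) = \<bar>t\<bar>\<^sup>n Vol K\<close>), so the partial derivatives are one-sided, taken within the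
  nonnegative orthant.
\<close>

definition volume_combination :: "'a::euclidean_space set list \<Rightarrow> (nat \<Rightarrow> real) \<Rightarrow> real" where
  "volume_combination Ks t = measure lebesgue (\<Sum>i<length Ks. (*\<^sub>R) (t i) ` (Ks ! i))"

definition partial_deriv :: "nat \<Rightarrow> ((nat \<Rightarrow> real) \<Rightarrow> real) \<Rightarrow> (nat \<Rightarrow> real) \<Rightarrow> real" where
  "partial_deriv i F t = vector_derivative (\<lambda>s. F (t(i := s))) (at (t i) within {0..})"

text \<open>To be used for lists of length \<open>DIM('a)\<close>.\<close>

definition mixed_volume :: "'a::euclidean_space set list \<Rightarrow> real" where
  "mixed_volume Ks =
     foldr partial_deriv [0..<length Ks] (volume_combination Ks) (\<lambda>_. 0) / fact (length Ks)"

definition quermassintegral :: "nat \<Rightarrow> 'a::euclidean_space set \<Rightarrow> real" where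
  "quermassintegral j K = mixed_volume (replicate (DIM('a) - j) K @ replicate j (cball 0 1))"

text \<open>
  Functions on the unit sphere are represented by functions on the whole space of which only the
  values on the sphere matter; e.g. the constant \<open>\<lambda>_. 1\<close> agrees with the support function of the
  unit ball.
\<close>

definition is_support_fun :: "('a::euclidean_space \<Rightarrow> real) \<Rightarrow> 'a set \<Rightarrow> bool" where
  "is_support_fun f K \<longleftrightarrow> convex_body K \<and> (\<forall>u\<in>sphere 0 1. f u = support_fun K u)"

text \<open>
  Every linear combination of support functions of convex bodies is a difference of two such
  functions, so this is their linear span.
\<close>

definition support_differences :: "('a::euclidean_space \<Rightarrow> real) set" where
  "support_differences =
     {f. \<exists>K L. convex_body K \<and> convex_body L \<and>
           (\<forall>u\<in>sphere 0 1. f u = support_fun K u - support_fun L u)}"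

definition multilinear_extension :: "(('a::euclidean_space \<Rightarrow> real) list \<Rightarrow> real) \<Rightarrow> bool" where
  "multilinear_extension W \<longleftrightarrow>
     (\<forall>fs Ks. length fs = DIM('a) \<longrightarrow> list_all2 is_support_fun fs Ks \<longrightarrow> W fs = mixed_volume Ks) \<and>
     (\<forall>fs i f g a b. length fs = DIM('a) \<longrightarrow> set fs \<subseteq> support_differences \<longrightarrow> i < DIM('a) \<longrightarrow>
        f \<in> support_differences \<longrightarrow> g \<in> support_differences \<longrightarrow>
        W (fs[i := (\<lambda>u. a * f u + b * g u)]) = a * W (fs[i := f]) + b * W (fs[i := g]))"

text \<open>
  Multilinearity determines \<open>W\<close> on the lists of length \<open>DIM('a)\<close> over \<open>support_differences\<close>; the
  choice only fixes irrelevant values elsewhere.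
\<close>

definition mixed_volume_fun :: "('a::euclidean_space \<Rightarrow> real) list \<Rightarrow> real" where
  "mixed_volume_fun = (SOME W. multilinear_extension W)"

definition even_part :: "('a::euclidean_space \<Rightarrow> real) \<Rightarrow> 'a \<Rightarrow> real" where
  "even_part h u = (h u + h (- u)) / 2"

definition odd_part :: "('a::euclidean_space \<Rightarrow> real) \<Rightarrow> 'a \<Rightarrow> real" where
  "odd_part h u = (h u - h (- u)) / 2"

definition central_symmetral :: "'a::euclidean_space set \<Rightarrow> 'a set" where
  "central_symmetral K = (*\<^sub>R) (1/2) ` (K + uminus ` K)"

definition reflection_path :: "'a::euclidean_space set \<Rightarrow> real \<Rightarrow> 'a set" where
  "reflection_path K t = (*\<^sub>R) ((1 + t) / 2) ` K + (*\<^sub>R) ((1 - t) / 2) ` (uminus ` K)"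

definition asymmetry :: "nat \<Rightarrow> 'a::euclidean_space set \<Rightarrow> real" where
  "asymmetry k K = quermassintegral (DIM('a) - k) (central_symmetral K)
                   - quermassintegral (DIM('a) - k) K"

end

theory Submission
  imports Defs "HOL-Combinatorics.Permutations"
begin

text \<open>
  Mixed volumes are multilinear because volume is an integral of determinants. For a polytope \<open>P\<close>
  with vertex set \<open>S\<close> the gradient of \<open>x \<mapsto> ln (\<Sum>y\<in>S. exp (y \<bullet> x))\<close> maps the space injectively onto
  \<open>P\<close> up to boundary points, so \<open>Vol P\<close> is the integral of the determinant of the Hessian. Potentials
  of several polytopes may be added with nonnegative coefficients, and the gradient of the sum fills
  the Minkowski sum; hence every polarization identity of determinants holds for volumes of Minkowski
  sums, first of polytopes and by exhaustion of convex bodies.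

  The extension of the mixed volume to differences of support functions exists and is unique, so it
  inherits symmetry and invariance under reflection from bodies. On the sphere the support function
  of \<open>K\<^sub>t\<close> is \<open>h\<^sub>e\<^sub>v\<^sub>e\<^sub>n + t h\<^sub>o\<^sub>d\<^sub>d\<close>. Expanding by multilinearity gives a polynomial in \<open>t\<close>, whose odd
  coefficients vanish because a reflection changes the sign of \<open>h\<^sub>o\<^sub>d\<^sub>d\<close>.
\<close>

section \<open>Polarization of the determinant\<close>

text \<open>The definition of \<open>mixed_volume\<close> by iterated one-sided derivatives does not
  presuppose that the volume of a Minkowski combination is a polynomial. The proof therefore works
  with the polarization of the volume, a finite signed sum that makes sense for any function, and
  evaluates the derivatives only once the multilinearity of this sum is known. Two restrictions
  shape the argument. Bodies can be combined only with nonnegative coefficients, whereas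
  \<open>odd_part\<close> is a genuine difference; relations with negative coefficients have to be
  reached by cancellation between Minkowski sums. Moreover coefficients may be zero, and a zero
  dilate has no interior, so the point \<open>{0}\<close> is carried along as a degenerate
  body.\<close>

text \<open>The inclusion-exclusion formula that recovers a symmetric \<open>n\<close>-linear form
  from its diagonal. The empty \<open>S\<close> contributes \<open>F 0\<close>; for sets under
  Minkowski addition \<open>0\<close> is the point \<open>{0}\<close>.\<close>

definition polarization :: "nat \<Rightarrow> ('a::comm_monoid_add \<Rightarrow> real) \<Rightarrow> (nat \<Rightarrow> 'a) \<Rightarrow> real" where
  "polarization n F A = (\<Sum>S\<in>Pow {..<n}. (-1) ^ card ({..<n} - S) * F (\<Sum>i\<in>S. A i)) / fact n"

text \<open>Complements \<open>N - S\<close> run through the subsets of \<open>N - Q\<close>, so the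
  sum expands a product of factors \<open>(-1) + 1\<close> over \<open>N - Q\<close>; only the empty
  product survives.\<close>

lemma sum_supersets_alternating:
  assumes "finite N" "Q \<subseteq> N"
  shows "(\<Sum>S\<in>{S\<in>Pow N. Q \<subseteq> S}. (-1) ^ card (N - S) :: real) = (if Q = N then 1 else 0)"
proof -
  have fin: "finite (N - Q)" using assms by auto
  have "(\<Sum>S\<in>{S\<in>Pow N. Q \<subseteq> S}. (-1) ^ card (N - S) :: real) = (\<Sum>T\<in>Pow (N - Q). (-1) ^ card T)"
    by (rule sum.reindex_bij_witness[where i="\<lambda>T. N - T" and j="\<lambda>S. N - S"]) (use assms in auto)
  also have "\<dots> = (\<Sum>T\<in>Pow (N - Q). (\<Prod>x\<in>T. -1) * (\<Prod>x\<in>(N-Q)-T. 1))"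
    by simp
  also have "\<dots> = (\<Prod>x\<in>N-Q. (-1) + 1)"
    using prod_add[OF fin, of "\<lambda>_. -1::real" "\<lambda>_. 1"] by simp
  also have "\<dots> = (if Q = N then 1 else 0)"
    using assms fin by (auto simp: card_gt_0_iff power_0_left)
  finally show ?thesis .
qed

text \<open>Each determinant expands row by row into a sum over maps \<open>\<phi>\<close> that tell
  from which matrix a row is taken. In the signed sum over \<open>S\<close> a map keeps a nonzero
  coefficient only if it uses all the matrices, hence each exactly once. The result is the mixed
  discriminant.\<close>

lemma polarization_det:
  fixes A :: "nat \<Rightarrow> real^'n^'n"
  shows "polarization CARD('n) det A =
    (\<Sum>\<phi> | bij_betw \<phi> UNIV {..<CARD('n)}. det (\<chi> r. A (\<phi> r) $ r)) / fact CARD('n)"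
proof -
  let ?N = "{..<CARD('n)}"
  let ?F = "{\<phi>::'n\<Rightarrow>nat. range \<phi> \<subseteq> ?N}"
  let ?d = "\<lambda>\<phi>. det (\<chi> r. A (\<phi> r) $ r)"
  have "finite (PiE (UNIV::'n set) (\<lambda>_. ?N))" by (intro finite_PiE) auto
  moreover have "PiE (UNIV::'n set) (\<lambda>_. ?N) = ?F" by (auto simp: PiE_def Pi_def)
  ultimately have fF: "finite ?F" by simp
  have det: "det (\<Sum>i\<in>S. A i) = (\<Sum>\<phi> | range \<phi> \<subseteq> S. ?d \<phi>)" if "finite S" for S
  proof -
    have PiE: "PiE (UNIV::'n set) (\<lambda>_. S) = {\<phi>. range \<phi> \<subseteq> S}" by (auto simp: PiE_def Pi_def)
    have "(\<Prod>r\<in>UNIV. \<Sum>i\<in>S. A i $ r $ p r) = (\<Sum>\<phi> | range \<phi> \<subseteq> S. \<Prod>r\<in>UNIV. A (\<phi> r) $ r $ p r)" for p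
      using prod_sum_PiE[of UNIV "\<lambda>_. S" "\<lambda>r i. A i $ r $ p r"] that by (simp add: PiE)
    then show ?thesis
      unfolding det_def by (simp add: sum_distrib_left) (rule sum.swap)
  qed
  have surj_iff: "range \<phi> = ?N \<longleftrightarrow> bij_betw \<phi> UNIV ?N" if "\<phi> \<in> ?F" for \<phi> :: "'n \<Rightarrow> nat"
    by (auto simp: bij_betw_def intro!: eq_card_imp_inj_on)
  have "(\<Sum>S\<in>Pow ?N. (-1) ^ card (?N - S) * det (\<Sum>i\<in>S. A i))
      = (\<Sum>S\<in>Pow ?N. \<Sum>\<phi> | \<phi> \<in> ?F \<and> range \<phi> \<subseteq> S. (-1) ^ card (?N - S) * ?d \<phi>)"
    by (intro sum.cong refl, subst det) (auto intro: finite_subset intro!: sum.cong simp: sum_distrib_left)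
  also have "\<dots> = (\<Sum>\<phi>\<in>?F. \<Sum>S | S \<in> Pow ?N \<and> range \<phi> \<subseteq> S. (-1) ^ card (?N - S) * ?d \<phi>)"
    by (rule sum.swap_restrict) (use fF in auto)
  also have "\<dots> = (\<Sum>\<phi>\<in>?F. if range \<phi> = ?N then ?d \<phi> else 0)"
    by (intro sum.cong refl, subst sum_distrib_right[symmetric], subst sum_supersets_alternating) auto
  also have "\<dots> = (\<Sum>\<phi>\<in>?F. if bij_betw \<phi> UNIV ?N then ?d \<phi> else 0)"
    by (intro sum.cong refl) (simp only: surj_iff)
  also have "\<dots> = (\<Sum>\<phi> | bij_betw \<phi> UNIV ?N. ?d \<phi>)"
    by (intro sum.mono_neutral_cong_right) (use fF in \<open>auto simp: bij_betw_def\<close>)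
  finally show ?thesis by (simp add: polarization_def)
qed

text \<open>By \<open>polarization_det\<close> every surviving term takes exactly one row from
  matrix \<open>k\<close>, and a determinant is linear in a single row.\<close>

lemma polarization_det_linear:
  fixes A :: "nat \<Rightarrow> real^'n^'n"
  assumes k: "k < CARD('n)"
  shows "polarization CARD('n) det (A(k := a *\<^sub>R X + b *\<^sub>R Y)) =
    a * polarization CARD('n) det (A(k := X)) + b * polarization CARD('n) det (A(k := Y))"
proof -
  have "det (\<chi> r. (A(k := a *\<^sub>R X + b *\<^sub>R Y)) (\<phi> r) $ r) =
      a * det (\<chi> r. (A(k := X)) (\<phi> r) $ r) + b * det (\<chi> r. (A(k := Y)) (\<phi> r) $ r)"
    if "bij_betw \<phi> (UNIV::'n set) {..<CARD('n)}" for \<phi>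
  proof -
    from that k obtain r0 where r0: "\<phi> r0 = k" unfolding bij_betw_def by (metis imageE lessThan_iff)
    have inj: "\<phi> r = k \<longleftrightarrow> r = r0" for r using that r0 unfolding bij_betw_def by (metis UNIV_I inj_onD)
    have upd: "(\<chi> r. (A(k := Z)) (\<phi> r) $ r) = (\<chi> r. if r = r0 then Z $ r else A (\<phi> r) $ r)" for Z
      by (simp add: vec_eq_iff inj)
    have if_row: "(\<chi> r. if r = r0 then c r else A (\<phi> r) $ r) = (\<chi> r. if r = r0 then c r0 else A (\<phi> r) $ r)"
      for c :: "'n \<Rightarrow> real^'n" by (simp add: vec_eq_iff)
    have "det (\<chi> r. if r = r0 then a *s X $ r + b *s Y $ r else A (\<phi> r) $ r) =
        a * det (\<chi> r. if r = r0 then X $ r else A (\<phi> r) $ r) +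
        b * det (\<chi> r. if r = r0 then Y $ r else A (\<phi> r) $ r)"
      using det_row_add[of r0 "\<lambda>r. a *s X $ r" "\<lambda>r. b *s Y $ r" "\<lambda>r. A (\<phi> r) $ r"]
       det_row_mul[of r0 a "\<lambda>r. X $ r" "\<lambda>r. A (\<phi> r) $ r"] det_row_mul[of r0 b "\<lambda>r. Y $ r" "\<lambda>r. A (\<phi> r) $ r"]
      by simp
    then show ?thesis unfolding upd by (simp add: scalar_mult_eq_scaleR cong: if_cong)
  qed
  then show ?thesis
    unfolding polarization_det by (simp add: sum.distrib sum_distrib_left add_divide_distrib[symmetric])
qed

text \<open>The number of terms in \<open>polarization_det\<close>; on the diagonal all of them
  equal \<open>det X\<close> and cancel the division by the factorial.\<close>

lemma card_bij_betw_UNIV: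
  "card {\<phi>. bij_betw \<phi> (UNIV::'n::finite set) {..<CARD('n)}} = fact CARD('n)"
proof -
  obtain g where g: "bij_betw g (UNIV::'n set) {..<CARD('n)}"
    using finite_same_card_bij[of "UNIV::'n set" "{..<CARD('n)}"] by auto
  have "bij_betw (\<lambda>p. g \<circ> p) {p. p permutes (UNIV::'n set)} {\<phi>. bij_betw \<phi> (UNIV::'n set) {..<CARD('n)}}"
  proof (rule bij_betwI[where g="\<lambda>\<phi>. inv g \<circ> \<phi>"])
    have gi: "inj g" using g by (auto simp: bij_betw_def)
    show "(\<lambda>p. g \<circ> p) \<in> {p. p permutes UNIV} \<rightarrow> {\<phi>. bij_betw \<phi> UNIV {..<CARD('n)}}"
      using g by (auto intro: bij_betw_trans permutes_imp_bij)
    have gb: "bij_betw (inv g) {..<CARD('n)} UNIV" using g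
      using bij_betw_inv_into by blast
    show "(\<lambda>\<phi>. inv g \<circ> \<phi>) \<in> {\<phi>. bij_betw \<phi> UNIV {..<CARD('n)}} \<rightarrow> {p. p permutes UNIV}"
      using gb by (auto intro!: bij_imp_permutes bij_betw_trans)
    show "inv g \<circ> (g \<circ> x) = x" if "x \<in> {p. p permutes UNIV}" for x
      using gi by (auto simp: fun_eq_iff)
    show "g \<circ> (inv g \<circ> y) = y" if "y \<in> {\<phi>. bij_betw \<phi> UNIV {..<CARD('n)}}" for y
    proof
      fix x have "y x \<in> range g" using that g by (auto simp: bij_betw_def)
      then show "(g \<circ> (inv g \<circ> y)) x = y x" by (simp add: f_inv_into_f)
    qed
  qed
  then show ?thesis
    using bij_betw_same_card card_permutations[OF refl, of "UNIV::'n set"] by fastforce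
qed

lemma polarization_det_same:
  "polarization CARD('n) det (\<lambda>_. X :: real^'n^'n) = det X"
  unfolding polarization_det by (simp add: card_bij_betw_UNIV)

section \<open>Change of variables for arbitrary finite index types\<close>

definition relabel :: "('a \<Rightarrow> 'b) \<Rightarrow> 'c^'b \<Rightarrow> 'c^'a" where
  "relabel \<sigma> x = (\<chi> i. x $ \<sigma> i)"

lemma relabel_nth [simp]: "relabel \<sigma> x $ i = x $ \<sigma> i"
  by (simp add: relabel_def)

lemma relabel_inv [simp]:
  assumes "bij \<sigma>"
  shows "relabel \<sigma> (relabel (inv \<sigma>) x) = x" "relabel (inv \<sigma>) (relabel \<sigma> y) = y"
  using assms by (simp_all add: vec_eq_iff bij_is_inj bij_is_surj surj_f_inv_f)

lemma norm_relabel: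
  fixes \<sigma> :: "'a::finite \<Rightarrow> 'b::finite" and x :: "real^'b"
  assumes "bij \<sigma>"
  shows "norm (relabel \<sigma> x) = norm x"
  using sum.reindex_bij_betw[OF assms, of "\<lambda>i. (x $ i)\<^sup>2"] by (simp add: norm_vec_def L2_set_def)

lemma linear_relabel: "linear (relabel \<sigma> :: real^'b \<Rightarrow> real^'a)"
  by (auto intro!: linearI simp: vec_eq_iff)

lemma relabel_cbox:
  fixes \<sigma> :: "'a::finite \<Rightarrow> 'b::finite" and a :: "real^'b"
  assumes "bij \<sigma>"
  shows "relabel \<sigma> ` cbox a b = cbox (relabel \<sigma> a) (relabel \<sigma> b)"
proof (intro set_eqI iffI)
  fix x assume x: "x \<in> cbox (relabel \<sigma> a) (relabel \<sigma> b)"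
  have "relabel (inv \<sigma>) x \<in> cbox a b"
    unfolding mem_box_cart
  proof
    fix i show "a $ i \<le> relabel (inv \<sigma>) x $ i \<and> relabel (inv \<sigma>) x $ i \<le> b $ i"
      using x[unfolded mem_box_cart, rule_format, of "inv \<sigma> i"] assms
      by (simp add: bij_is_surj surj_f_inv_f)
  qed
  then show "x \<in> relabel \<sigma> ` cbox a b"
    using assms by (intro image_eqI[of _ _ "relabel (inv \<sigma>) x"]) auto
qed (auto simp: mem_box_cart)

lemma content_relabel_cbox:
  fixes \<sigma> :: "'a::finite \<Rightarrow> 'b::finite" and a :: "real^'b"
  assumes "bij \<sigma>"
  shows "measure lborel (relabel \<sigma> ` cbox a b) = measure lborel (cbox a b)"
proof -
  have ne: "cbox (relabel \<sigma> a) (relabel \<sigma> b) = {} \<longleftrightarrow> cbox a b = {}"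
    unfolding relabel_cbox[OF assms, symmetric] by simp
  have "(\<Prod>i\<in>UNIV. b $ \<sigma> i - a $ \<sigma> i) = (\<Prod>i\<in>UNIV. b $ i - a $ i)"
    by (rule prod.reindex_bij_betw[OF assms, of "\<lambda>i. b $ i - a $ i"])
  then show ?thesis
    unfolding relabel_cbox[OF assms] by (simp add: content_cbox_if_cart ne)
qed

text \<open>Relabelling maps boxes to boxes of the same content, which settles integrals over boxes.
  Integrals over \<open>UNIV\<close> are limits over boxes that contain a large ball, and balls are
  preserved by \<open>norm_relabel\<close>.\<close>

lemma has_integral_relabel:
  fixes \<sigma> :: "'a::finite \<Rightarrow> 'b::finite" and f :: "real^'a \<Rightarrow> 'c::banach"
  assumes \<sigma>: "bij \<sigma>" and f: "(f has_integral i) UNIV"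
  shows "((\<lambda>x. f (relabel \<sigma> x)) has_integral i) UNIV"
proof (subst has_integral_alt', intro conjI allI impI)
  have \<tau>: "bij (inv \<sigma>)" using \<sigma> by (rule bij_imp_bij_inv)
  have *: "((\<lambda>x. f (relabel \<sigma> x)) has_integral z) (cbox a b)" 
    if "(f has_integral z) (cbox (relabel \<sigma> a) (relabel \<sigma> b))" for a b z
  proof -
    \<comment> \<open>The \<open>1 / 1\<close> is the reciprocal of the factor by which the map
      scales content, in the form that \<open>has_integral_twiddle\<close> produces.\<close>
    have "((\<lambda>x. f (relabel \<sigma> x)) has_integral (1 / 1) *\<^sub>R z)
        (relabel (inv \<sigma>) ` cbox (relabel \<sigma> a) (relabel \<sigma> b))"
    proof (rule has_integral_twiddle[OF _ _ _ _ _ _ _ that])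
      show "isCont (relabel \<sigma> :: real^'b \<Rightarrow> real^'a) x" for x
        using linear_continuous_at linear_conv_bounded_linear linear_relabel by blast
      show "measure lborel (relabel \<sigma> ` cbox u v) = 1 * measure lborel (cbox u v)" for u v :: "real^'b"
        by (simp add: content_relabel_cbox[OF \<sigma>])
    qed (auto simp: relabel_cbox[OF \<sigma>] relabel_cbox[OF \<tau>] \<sigma>)
    then show ?thesis by (simp add: relabel_cbox[OF \<tau>] \<sigma>)
  qed
  have int: "f integrable_on cbox a b" for a b
    using f has_integral_alt'[of f i UNIV] by auto
  show "(\<lambda>x. if x \<in> UNIV then f (relabel \<sigma> x) else 0) integrable_on cbox a b" for a b
    using *[OF integrable_integral[OF int]] by auto
  have eq: "integral (cbox a b) (\<lambda>x. f (relabel \<sigma> x)) = integral (cbox (relabel \<sigma> a) (relabel \<sigma> b)) f" for a b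
    using *[OF integrable_integral[OF int]] by (rule integral_unique)
  fix e :: real assume "e > 0"
  then have "\<exists>B>0. \<forall>a b. ball 0 B \<subseteq> cbox a b \<longrightarrow> norm (integral (cbox a b) f - i) < e"
    using f has_integral_alt'[of f i UNIV] by auto
  then obtain B where B: "B > 0" "\<And>a b. ball 0 B \<subseteq> cbox a b \<Longrightarrow> norm (integral (cbox a b) f - i) < e"
    by blast
  show "\<exists>B>0. \<forall>a b. ball 0 B \<subseteq> cbox a b \<longrightarrow>
        norm (integral (cbox a b) (\<lambda>x. if x \<in> UNIV then f (relabel \<sigma> x) else 0) - i) < e"
  proof (intro exI[of _ B] conjI allI impI B)
    fix a b :: "real^'b" assume ab: "ball 0 B \<subseteq> cbox a b"
    have "ball 0 B \<subseteq> cbox (relabel \<sigma> a) (relabel \<sigma> b)"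
    proof
      fix x :: "real^'a" assume "x \<in> ball 0 B"
      then have "relabel (inv \<sigma>) x \<in> cbox a b" using ab by (auto simp: norm_relabel[OF \<tau>])
      then have "relabel \<sigma> (relabel (inv \<sigma>) x) \<in> relabel \<sigma> ` cbox a b" by blast
      then show "x \<in> cbox (relabel \<sigma> a) (relabel \<sigma> b)" by (simp add: relabel_cbox[OF \<sigma>] \<sigma>)
    qed
    then show "norm (integral (cbox a b) (\<lambda>x. if x \<in> UNIV then f (relabel \<sigma> x) else 0) - i) < e"
      using B by (simp add: eq)
  qed
qed

text \<open>Rows and columns are relabelled together: conjugation by \<open>\<sigma>\<close> carries
  the permutations of one index type to those of the other and keeps their sign.\<close>

lemma det_relabel:
  fixes \<sigma> :: "'a::finite \<Rightarrow> 'b::finite" and A :: "real^'b^'b"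
  assumes \<sigma>: "bij \<sigma>"
  shows "det (\<chi> i j. A $ \<sigma> i $ \<sigma> j) = det A"
proof -
  have inj: "inj \<sigma>" using \<sigma> bij_is_inj by auto
  have "det A = (\<Sum>p | p permutes (UNIV::'a set).
      of_int (sign (map_permutation UNIV \<sigma> p)) * (\<Prod>i\<in>UNIV. A $ i $ map_permutation UNIV \<sigma> p i))"
    unfolding det_def
  proof (rule sum.reindex_bij_betw[symmetric])
    have "map_permutation UNIV \<sigma> = (\<lambda>p x. if x \<in> UNIV then \<sigma> (p (inv \<sigma> x)) else x)"
      using \<sigma> by (simp add: map_permutation_def restrict_id_def fun_eq_iff bij_is_surj)
    then show "bij_betw (map_permutation UNIV \<sigma>) {p. p permutes (UNIV::'a set)} {p. p permutes (UNIV::'b set)}"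
      using bij_betw_permutations[OF \<sigma>] by (simp only:)
  qed
  also have "\<dots> = (\<Sum>p | p permutes (UNIV::'a set). of_int (sign p) * (\<Prod>i\<in>UNIV. A $ \<sigma> i $ \<sigma> (p i)))"
  proof (intro sum.cong refl)
    fix p assume "p \<in> {p. p permutes (UNIV::'a set)}"
    then have p: "p permutes (UNIV::'a set)" by simp
    have "(\<Prod>i\<in>UNIV. A $ i $ map_permutation UNIV \<sigma> p i) = (\<Prod>i\<in>UNIV. A $ \<sigma> i $ map_permutation UNIV \<sigma> p (\<sigma> i))"
      by (rule prod.reindex_bij_betw[OF \<sigma>, symmetric])
    also have "\<dots> = (\<Prod>i\<in>UNIV. A $ \<sigma> i $ \<sigma> (p i))"
      by (simp add: map_permutation_apply[OF inj])
    finally show "of_int (sign (map_permutation UNIV \<sigma> p)) * (\<Prod>i\<in>UNIV. A $ i $ map_permutation UNIV \<sigma> p i)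
      = of_int (sign p) * (\<Prod>i\<in>UNIV. A $ \<sigma> i $ \<sigma> (p i))"
      using sign_map_permutation[OF inj p finite] by simp
  qed
  finally show ?thesis by (simp add: det_def)
qed

text \<open>
  The change of variables theorem is stated for index types that carry a well-order. A copy of the
  index type that is ordered along an arbitrary enumeration makes it available for all finite types.
\<close>

typedef 'a ordered_copy = "UNIV :: 'a::finite set" by simp

lemma bij_Rep_ordered_copy: "bij (Rep_ordered_copy :: 'a::finite ordered_copy \<Rightarrow> 'a)"
  by (rule bij_betw_byWitness[where f'=Abs_ordered_copy])
    (auto simp: Rep_ordered_copy_inverse Abs_ordered_copy_inverse)

instance ordered_copy :: (finite) finite
  by standard (use bij_betw_finite[OF bij_Rep_ordered_copy] in simp)

definition copy_index :: "'a::finite ordered_copy \<Rightarrow> nat" where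
  "copy_index = (SOME g. inj g)"

lemma inj_copy_index: "inj copy_index"
proof -
  have "\<exists>g :: 'a ordered_copy \<Rightarrow> nat. inj g"
    using finite_imp_inj_to_nat_seg[of "UNIV :: 'a ordered_copy set"] by auto
  then show ?thesis unfolding copy_index_def by (rule someI_ex)
qed

instantiation ordered_copy :: (finite) wellorder
begin

definition less_eq_ordered_copy :: "'a ordered_copy \<Rightarrow> 'a ordered_copy \<Rightarrow> bool" where
  "less_eq_ordered_copy x y \<longleftrightarrow> copy_index x \<le> copy_index y"

definition less_ordered_copy :: "'a ordered_copy \<Rightarrow> 'a ordered_copy \<Rightarrow> bool" where
  "less_ordered_copy x y \<longleftrightarrow> copy_index x < copy_index y"

instance
proof
  fix P :: "'a ordered_copy \<Rightarrow> bool" and a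
  assume step: "\<And>x. (\<And>y. y < x \<Longrightarrow> P y) \<Longrightarrow> P x"
  show "P a"
  proof (induction a rule: measure_induct_rule[of copy_index])
    case (less x)
    show ?case by (rule step) (simp add: less less_ordered_copy_def)
  qed
qed (auto simp: less_eq_ordered_copy_def less_ordered_copy_def dest: injD[OF inj_copy_index])

end

text \<open>\<open>G\<close> is conjugated with the relabelling onto the ordered copy, where the
  change of variables theorem applies. Determinants and measures are the same on both sides.\<close>

lemma has_integral_det_Jacobian:
  fixes G :: "real^'n \<Rightarrow> real^'n" and M :: "real^'n \<Rightarrow> real^'n^'n"
  assumes der: "\<And>x. (G has_derivative (\<lambda>h. M x *v h)) (at x)"
    and inj: "inj G" and meas: "range G \<in> lmeasurable"
  shows "((\<lambda>x. \<bar>det (M x)\<bar>) has_integral measure lebesgue (range G)) UNIV"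
proof -
  let ?\<rho> = "Rep_ordered_copy :: 'n ordered_copy \<Rightarrow> 'n"
  have \<rho>: "bij ?\<rho>" by (rule bij_Rep_ordered_copy)
  define \<tau> where "\<tau> = inv ?\<rho>"
  have \<tau>: "bij \<tau>" unfolding \<tau>_def using \<rho> by (rule bij_imp_bij_inv)
  have inv [simp]: "relabel ?\<rho> (relabel \<tau> x) = x" "relabel \<tau> (relabel ?\<rho> y) = y" for x :: "real^('n ordered_copy)" and y :: "real^'n"
    using \<rho> by (simp_all add: \<tau>_def)
  have blr: "(relabel s has_derivative relabel s) F" for s :: "'a::finite \<Rightarrow> 'b::finite" and F :: "(real^'b) filter"
    using linear_relabel[of s] linear_conv_bounded_linear by (intro bounded_linear_imp_has_derivative) blast
  define g where "g x = relabel ?\<rho> (G (relabel \<tau> x))" for x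
  define g' where "g' x h = relabel ?\<rho> (M (relabel \<tau> x) *v relabel \<tau> h)" for x h
  have g': "(g has_derivative g' x) (at x)" for x
    unfolding g_def g'_def
    by (rule diff_chain_at[OF diff_chain_at[OF blr der] blr, unfolded o_def])
  have mat: "det (matrix (g' x)) = det (M (relabel \<tau> x))" for x
  proof -
    have "matrix (g' x) = (\<chi> i j. M (relabel \<tau> x) $ ?\<rho> i $ ?\<rho> j)"
    proof -
      have ax: "relabel \<tau> (axis j 1 :: real^('n ordered_copy)) = axis (?\<rho> j) 1" for j
        using \<rho> by (auto simp: vec_eq_iff axis_def \<tau>_def bij_is_surj surj_f_inv_f bij_is_inj)
      show ?thesis
        unfolding matrix_def g'_def ax
        by (simp add: vec_eq_iff matrix_vector_mul_component inner_axis)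
    qed
    then show ?thesis by (simp add: det_relabel[OF \<rho>])
  qed
  have injg: "inj g"
  proof (rule injI)
    fix x y assume "g x = g y"
    then have "relabel \<tau> (g x) = relabel \<tau> (g y)" by simp
    then have "relabel \<tau> x = relabel \<tau> y" using injD[OF inj] by (simp add: g_def)
    then have "relabel ?\<rho> (relabel \<tau> x) = relabel ?\<rho> (relabel \<tau> y)" by simp
    then show "x = y" by simp
  qed
  have "range g = relabel ?\<rho> ` range G"
  proof -
    have "range g = (\<lambda>x. relabel ?\<rho> (G x)) ` range (relabel \<tau>)" by (auto simp: g_def)
    also have "range (relabel \<tau> :: real^('n ordered_copy) \<Rightarrow> real^'n) = UNIV" by (intro surjI[where f="relabel ?\<rho>"] inv)
    finally show ?thesis by (simp add: image_image)
  qed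
  then have mem: "x \<in> range g \<longleftrightarrow> relabel \<tau> x \<in> range G" for x
  proof -
    have "x \<in> relabel ?\<rho> ` S \<longleftrightarrow> relabel \<tau> x \<in> S" for S
    proof
      assume "relabel \<tau> x \<in> S"
      then have "relabel ?\<rho> (relabel \<tau> x) \<in> relabel ?\<rho> ` S" by (rule imageI)
      then show "x \<in> relabel ?\<rho> ` S" by simp
    qed auto
    with \<open>range g = _\<close> show ?thesis by simp
  qed
  \<comment> \<open>Measurability and measure of \<open>range g\<close> are transported through the
    integral of the indicator function.\<close>
  have "((\<lambda>y. indicat_real (range G) y) has_integral measure lebesgue (range G)) UNIV"
    using meas lmeasurable_iff_has_integral by blast
  then have "((\<lambda>y. indicat_real (range G) (relabel \<tau> y)) has_integral measure lebesgue (range G)) UNIV"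
    by (rule has_integral_relabel[OF \<tau>])
  also have "(\<lambda>y. indicat_real (range G) (relabel \<tau> y)) = indicat_real (range g)"
    by (simp add: fun_eq_iff indicator_def mem del: range_eqI)
  finally have ig: "range g \<in> lmeasurable \<and> measure lebesgue (range g) = measure lebesgue (range G)"
    using lmeasurable_iff_indicator_has_integral[of "range g" "measure lebesgue (range G)"] by auto
  have "((\<lambda>x. \<bar>det (matrix (g' x))\<bar>) has_integral measure lebesgue (range G)) UNIV"
  proof (subst has_measure_differentiable_image[symmetric, OF _ g' injg])
    show "(UNIV :: (real^('n ordered_copy)) set) \<in> sets lebesgue" by simp
    show "range g \<in> lmeasurable \<and> measure lebesgue (range g) = measure lebesgue (range G)" by (rule ig)
  qed
  then have "((\<lambda>x. \<bar>det (M (relabel \<tau> x))\<bar>) has_integral measure lebesgue (range G)) UNIV"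
    by (simp add: mat)
  from has_integral_relabel[OF \<rho> this] show ?thesis by (simp only: inv)
qed

section \<open>Bodies as gradient images\<close>

text \<open>The segment from the identity to \<open>M\<close> consists of matrices that are again
  positive on nonzero vectors, hence have trivial kernel. The determinant cannot vanish along it and
  keeps the sign that it has at the identity.\<close>

lemma det_pos_if_positive_definite:
  fixes M :: "real^'n^'n"
  assumes pos: "\<And>h. h \<noteq> 0 \<Longrightarrow> h \<bullet> (M *v h) > 0"
  shows "det M > 0"
proof (rule ccontr)
  assume neg: "\<not> det M > 0"
  define c where "c s = det ((1 - s) *\<^sub>R mat 1 + s *\<^sub>R M)" for s :: real
  have "continuous_on {0..1} c"
    unfolding c_def det_def by (intro continuous_intros)
  moreover have "c 0 = 1" "c 1 = det M" by (simp_all add: c_def)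
  ultimately obtain s where s: "0 \<le> s" "s \<le> 1" "c s = 0"
    using IVT2'[of c 1 0 0] neg by auto
  let ?A = "(1 - s) *\<^sub>R mat 1 + s *\<^sub>R M"
  have "\<not> invertible ?A" using s(3) unfolding c_def invertible_det_nz by simp
  then obtain h where h: "h \<noteq> 0" "?A *v h = 0"
    unfolding invertible_left_inverse matrix_left_invertible_ker by blast
  have "h \<bullet> (?A *v h) = (1 - s) * (h \<bullet> h) + s * (h \<bullet> (M *v h))"
    by (simp add: matrix_vector_mult_add_rdistrib inner_add_right scaleR_matrix_vector_assoc[symmetric])
  moreover have "h \<bullet> h > 0" using h by simp
  ultimately have "h \<bullet> (?A *v h) > 0"
    using pos[OF h(1)] s
    \<comment> \<open>For \<open>s = 0\<close> positivity comes from the identity, otherwise from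
      \<open>M\<close>.\<close>
    by (cases "s = 0") (auto intro!: add_nonneg_pos)
  then show False using h by simp
qed

text \<open>
  Gromov's representation of a body as the closure of the image of the gradient of a strictly convex
  potential with Hessian \<open>M\<close>. The Hessian depends additively on the body, which makes mixed volumes
  integrals of mixed discriminants.
\<close>

definition gradient_body :: "(real^'n) set \<Rightarrow> (real^'n \<Rightarrow> real^'n^'n) \<Rightarrow> bool" where
  "gradient_body P M \<longleftrightarrow> (\<exists>f G.
     (\<forall>x. (f has_derivative (\<lambda>h. G x \<bullet> h)) (at x)) \<and>
     (\<forall>x. (G has_derivative (\<lambda>h. M x *v h)) (at x)) \<and>
     (\<forall>x. G x \<in> P) \<and> (\<forall>x. \<forall>q\<in>P. q \<bullet> x \<le> f x) \<and>
     ((\<forall>x h. h \<noteq> 0 \<longrightarrow> h \<bullet> (M x *v h) > 0) \<or> P = {0} \<and> (\<forall>x. M x = 0)))"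

text \<open>For an interior point \<open>q\<close> the function \<open>f x - q \<bullet> x\<close>
  is coercive, because \<open>f\<close> dominates the pairing with a whole ball around
  \<open>q\<close>. It attains a minimum, and the critical point equation there is
  \<open>G x = q\<close>.\<close>

lemma interior_subset_range_gradient:
  fixes G :: "real^'n \<Rightarrow> real^'n"
  assumes f: "\<And>x. (f has_derivative (\<lambda>h. G x \<bullet> h)) (at x)"
    and ge: "\<And>x q. q \<in> P \<Longrightarrow> q \<bullet> x \<le> f x"
  shows "interior P \<subseteq> range G"
proof
  fix q assume "q \<in> interior P"
  then obtain e where e: "e > 0" "cball q e \<subseteq> P" by (meson mem_interior_cball)
  define g where "g x = f x - q \<bullet> x" for x
  have cont: "continuous_on S g" for S
    unfolding g_def using f by (intro continuous_intros) (meson continuous_at_imp_continuous_on has_derivative_continuous)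
  have growth: "e * norm x \<le> g x" for x
  proof (cases "x = 0")
    case True
    have "q \<in> P" using e by auto
    then show ?thesis using ge[of q x] True by (simp add: g_def)
  next
    case False
    \<comment> \<open>The point of the ball that is farthest in direction \<open>x\<close> gains
      \<open>e * norm x\<close>.\<close>
    have "q + (e / norm x) *\<^sub>R x \<in> P"
      using e False by (intro subsetD[OF e(2)]) (auto simp: dist_norm)
    from ge[OF this, of x] show ?thesis
      using False by (simp add: g_def inner_add_left dot_square_norm power2_eq_square)
  qed
  \<comment> \<open>Outside this radius \<open>e * norm y\<close> exceeds \<open>g 0\<close>, so a
    minimum over the ball is global; the summand 1 keeps the radius positive.\<close>
  define R where "R = (\<bar>g 0\<bar> + 1) / e"
  have R: "R > 0" using e by (simp add: R_def)
  obtain x where x: "x \<in> cball 0 R" "\<And>y. y \<in> cball 0 R \<Longrightarrow> g x \<le> g y"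
    using continuous_attains_inf[OF compact_cball _ cont, of 0 R] R by fastforce
  have min: "g x \<le> g y" for y
  proof (cases "y \<in> cball 0 R")
    case False
    then have "norm y > R" by simp
    then have "e * norm y > e * R" using e by simp
    then have "e * norm y > g 0" using e by (simp add: R_def)
    moreover have "g x \<le> g 0" using x(2)[of 0] R by simp
    ultimately show ?thesis using growth[of y] by linarith
  qed (use x in auto)
  have "(g has_derivative (\<lambda>h. G x \<bullet> h - q \<bullet> h)) (at x)"
    unfolding g_def by (intro derivative_intros f)
  then have "(\<lambda>h. G x \<bullet> h - q \<bullet> h) = (\<lambda>h. 0)"
    using differential_zero_maxmin[of x UNIV g] min by auto
  then have "(G x - q) \<bullet> (G x - q) = 0"
    by (metis inner_diff_left)
  then have "G x = q" by simp
  then show "q \<in> range G" by blast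
qed

text \<open>Along the segment between two distinct points the component of \<open>G\<close> in the
  direction of the segment has positive derivative, so the end points have different images.\<close>

lemma inj_gradient:
  fixes G :: "real^'n \<Rightarrow> real^'n"
  assumes G: "\<And>x. (G has_derivative (\<lambda>h. M x *v h)) (at x)"
    and pos: "\<And>x h. h \<noteq> 0 \<Longrightarrow> h \<bullet> (M x *v h) > 0"
  shows "inj G"
proof (rule injI, rule ccontr)
  fix x y assume xy: "G x = G y" "x \<noteq> y"
  define d where "d = y - x"
  define \<phi> where "\<phi> s = d \<bullet> G (x + s *\<^sub>R d)" for s :: real
  have der: "(\<phi> has_real_derivative (d \<bullet> (M (x + s *\<^sub>R d) *v d))) (at s)" for s
  proof -
    have "((\<lambda>s. G (x + s *\<^sub>R d)) has_derivative (\<lambda>t. M (x + s *\<^sub>R d) *v (t *\<^sub>R d))) (at s)"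
      by (rule has_derivative_compose[OF _ G, where f="\<lambda>s. x + s *\<^sub>R d"]) (auto intro!: derivative_eq_intros)
    then have "(\<phi> has_derivative (\<lambda>t. d \<bullet> (M (x + s *\<^sub>R d) *v (t *\<^sub>R d)))) (at s)"
      unfolding \<phi>_def by (rule has_derivative_inner_right)
    then show ?thesis
      by (simp add: has_field_derivative_def matrix_vector_mult_scaleR mult.commute[of _ "d \<bullet> _"])
  qed
  have "\<phi> 0 < \<phi> 1"
    by (rule DERIV_pos_imp_increasing[of 0 1 \<phi>]) (use der pos xy in \<open>force simp: d_def\<close>)+
  then show False using xy by (simp add: \<phi>_def d_def)
qed

text \<open>The range of \<open>G\<close> lies between \<open>interior P\<close> and
  \<open>P\<close>, and the frontier of a convex set is null. Positivity of the Hessian removes the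
  absolute value from the Jacobian. For \<open>{0}\<close> both sides vanish.\<close>

lemma has_integral_det_gradient_body:
  fixes M :: "real^'n \<Rightarrow> real^'n^'n"
  assumes M: "gradient_body P M" and P: "compact P" "convex P"
  shows "((\<lambda>x. det (M x)) has_integral measure lebesgue P) UNIV"
proof -
  obtain f G where f: "\<And>x. (f has_derivative (\<lambda>h. G x \<bullet> h)) (at x)"
    and G: "\<And>x. (G has_derivative (\<lambda>h. M x *v h)) (at x)"
    and GP: "\<And>x. G x \<in> P" and ge: "\<And>x q. q \<in> P \<Longrightarrow> q \<bullet> x \<le> f x"
    and or: "(\<forall>x h. h \<noteq> 0 \<longrightarrow> h \<bullet> (M x *v h) > 0) \<or> P = {0} \<and> (\<forall>x. M x = 0)"
    using M unfolding gradient_body_def by blast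
  show ?thesis
  proof (cases "\<forall>x h. h \<noteq> 0 \<longrightarrow> h \<bullet> (M x *v h) > 0")
    case True
    have int: "interior P \<subseteq> range G" by (rule interior_subset_range_gradient[OF f ge])
    have negl: "negligible (frontier P)" using P by (intro negligible_convex_frontier)
    have Pm: "P \<in> lmeasurable" using P by (intro lmeasurable_compact)
    have "sym_diff P (range G) \<subseteq> frontier P"
      using int GP P by (auto simp: frontier_def closure_closed[OF compact_imp_closed])
    then have n: "negligible (sym_diff P (range G))" using negl negligible_subset by blast
    have rG: "range G \<in> lmeasurable" "measure lebesgue (range G) = measure lebesgue P"
      using lmeasurable_negligible_symdiff[OF Pm n] measure_negligible_symdiff[OF Pm n] by auto
    have "((\<lambda>x. \<bar>det (M x)\<bar>) has_integral measure lebesgue (range G)) UNIV"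
      by (rule has_integral_det_Jacobian[OF G inj_gradient[OF G] rG(1)]) (use True in auto)
    moreover have "\<bar>det (M x)\<bar> = det (M x)" for x
      using det_pos_if_positive_definite[of "M x"] True by simp
    ultimately show ?thesis by (simp add: rG)
  next
    case False
    then have "P = {0}" "\<And>x. M x = 0" using or by auto
    moreover have "det (0 :: real^'n^'n) = 0" by (rule det_zero_row(1)[of undefined]) (simp add: row_def vec_eq_iff)
    ultimately show ?thesis by simp
  qed
qed

lemma gradient_body_zero: "gradient_body {0} (\<lambda>_. 0)"
  unfolding gradient_body_def
  by (intro exI[of _ "\<lambda>_. 0"]) (auto intro!: derivative_eq_intros)

text \<open>All clauses add up because \<open>f\<close> only has to dominate the pairing with points
  of \<open>P\<close> instead of being its support function. A definite Hessian stays definite when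
  a semidefinite one is added, and a degenerate summand contributes the Hessian 0.\<close>

lemma gradient_body_add:
  assumes "gradient_body P M" "gradient_body Q N"
  shows "gradient_body (P + Q) (\<lambda>x. M x + N x)"
proof -
  obtain f G where f: "\<And>x. (f has_derivative (\<lambda>h. G x \<bullet> h)) (at x)"
    "\<And>x. (G has_derivative (\<lambda>h. M x *v h)) (at x)"
    "\<And>x. G x \<in> P" "\<And>x q. q \<in> P \<Longrightarrow> q \<bullet> x \<le> f x"
    "(\<forall>x h. h \<noteq> 0 \<longrightarrow> h \<bullet> (M x *v h) > 0) \<or> P = {0} \<and> (\<forall>x. M x = 0)"
    using assms(1) unfolding gradient_body_def by blast
  obtain f' G' where f': "\<And>x. (f' has_derivative (\<lambda>h. G' x \<bullet> h)) (at x)"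
    "\<And>x. (G' has_derivative (\<lambda>h. N x *v h)) (at x)"
    "\<And>x. G' x \<in> Q" "\<And>x q. q \<in> Q \<Longrightarrow> q \<bullet> x \<le> f' x"
    "(\<forall>x h. h \<noteq> 0 \<longrightarrow> h \<bullet> (N x *v h) > 0) \<or> Q = {0} \<and> (\<forall>x. N x = 0)"
    using assms(2) unfolding gradient_body_def by blast
  show ?thesis
    unfolding gradient_body_def
  proof (intro exI[of _ "\<lambda>x. f x + f' x"] exI[of _ "\<lambda>x. G x + G' x"] conjI allI ballI)
    show "((\<lambda>x. f x + f' x) has_derivative (\<lambda>h. (G x + G' x) \<bullet> h)) (at x)" for x
      unfolding inner_add_left by (intro derivative_intros f f')
    show "((\<lambda>x. G x + G' x) has_derivative (\<lambda>h. (M x + N x) *v h)) (at x)" for x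
      unfolding matrix_vector_mult_add_rdistrib by (intro derivative_intros f f')
    show "G x + G' x \<in> P + Q" for x using f f' by (auto intro: set_plus_intro)
    show "q \<bullet> x \<le> f x + f' x" if "q \<in> P + Q" for q x
      using that by (auto elim!: set_plus_elim simp: inner_add_left intro!: add_mono f(4) f'(4))
    have nonneg: "h \<bullet> (A x *v h) \<ge> 0"
      if "(\<forall>x h. h \<noteq> 0 \<longrightarrow> h \<bullet> (A x *v h) > 0) \<or> R = {0} \<and> (\<forall>x. A x = 0)"
      for A :: "real^'n \<Rightarrow> real^'n^'n" and R :: "(real^'n) set" and x h
      using that by (cases "h = 0") (auto intro: less_imp_le)
    then show "(\<forall>x h. h \<noteq> 0 \<longrightarrow> 0 < h \<bullet> ((M x + N x) *v h)) \<or> P + Q = {0} \<and> (\<forall>x. M x + N x = 0)"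
      using f(5) f'(5)
      by (auto simp: matrix_vector_mult_add_rdistrib inner_add_right
          intro: add_pos_nonneg[OF _ nonneg[OF f'(5)]] add_nonneg_pos[OF nonneg[OF f(5)]])
  qed
qed

lemma gradient_body_scaleR:
  assumes "gradient_body P M" "t \<ge> 0"
  shows "gradient_body ((*\<^sub>R) t ` P) (\<lambda>x. t *\<^sub>R M x)"
proof -
  obtain f G where f: "\<And>x. (f has_derivative (\<lambda>h. G x \<bullet> h)) (at x)"
    "\<And>x. (G has_derivative (\<lambda>h. M x *v h)) (at x)"
    "\<And>x. G x \<in> P" "\<And>x q. q \<in> P \<Longrightarrow> q \<bullet> x \<le> f x"
    "(\<forall>x h. h \<noteq> 0 \<longrightarrow> h \<bullet> (M x *v h) > 0) \<or> P = {0} \<and> (\<forall>x. M x = 0)"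
    using assms(1) unfolding gradient_body_def by blast
  show ?thesis
    unfolding gradient_body_def
  proof (intro exI[of _ "\<lambda>x. t * f x"] exI[of _ "\<lambda>x. t *\<^sub>R G x"] conjI allI ballI)
    show "((\<lambda>x. t * f x) has_derivative (\<lambda>h. (t *\<^sub>R G x) \<bullet> h)) (at x)" for x
      unfolding inner_scaleR_left by (intro derivative_intros f)
    show "((\<lambda>x. t *\<^sub>R G x) has_derivative (\<lambda>h. (t *\<^sub>R M x) *v h)) (at x)" for x
      unfolding scaleR_matrix_vector_assoc[symmetric] by (intro derivative_intros f)
    show "t *\<^sub>R G x \<in> (*\<^sub>R) t ` P" for x using f by auto
    show "q \<bullet> x \<le> t * f x" if "q \<in> (*\<^sub>R) t ` P" for q x
      using that assms(2) by (auto intro!: mult_left_mono f(4))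
    \<comment> \<open>The dilate by 0 falls under the degenerate alternative in
      \<open>gradient_body\<close>.\<close>
    have "(*\<^sub>R) 0 ` P = {0}" using f(3) by auto
    then show "(\<forall>x h. h \<noteq> 0 \<longrightarrow> 0 < h \<bullet> ((t *\<^sub>R M x) *v h)) \<or> (*\<^sub>R) t ` P = {0} \<and> (\<forall>x. t *\<^sub>R M x = 0)"
      using f(5) assms(2) by (cases "t = 0") (auto simp: scaleR_matrix_vector_assoc[symmetric])
  qed
qed

section \<open>Log-sum-exp potentials of polytopes and exhaustion from inside\<close>

text \<open>The weights \<open>w y x\<close> form a Gibbs distribution on \<open>S\<close>;
  \<open>G x\<close> is its mean, which lies in the hull, and \<open>D x\<close> its covariance. So
  \<open>h \<bullet> D x h\<close> is the variance of \<open>y \<bullet> h\<close>, positive because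
  a set whose hull has interior points is not contained in a hyperplane.\<close>

lemma gradient_body_polytope:
  fixes S :: "(real^'n) set"
  assumes S: "finite S" "interior (convex hull S) \<noteq> {}"
  shows "\<exists>M. gradient_body (convex hull S) M"
proof -
  define Z where "Z x = (\<Sum>y\<in>S. exp (y \<bullet> x))" for x
  define w where "w y x = exp (y \<bullet> x) / Z x" for y x
  define G where "G x = (\<Sum>y\<in>S. w y x *\<^sub>R y)" for x
  define D where "D x h = (\<Sum>y\<in>S. (w y x * ((y - G x) \<bullet> h)) *\<^sub>R y)" for x h
  have S0: "S \<noteq> {}" using S(2) by auto
  have Z: "Z x > 0" for x unfolding Z_def using S S0 by (intro sum_pos) auto
  have w: "w y x > 0" for y x using Z by (simp add: w_def)
  have sw: "(\<Sum>y\<in>S. w y x) = 1" for x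
    using Z[of x] by (simp add: w_def sum_divide_distrib[symmetric]) (simp add: Z_def)
  have dexp: "((\<lambda>x. exp (y \<bullet> x)) has_derivative (\<lambda>h. exp (y \<bullet> x) * (y \<bullet> h))) (at x)" for x y :: "real^'n"
    by (auto intro!: derivative_eq_intros)
  have "Z x * (G x \<bullet> h) = (\<Sum>y\<in>S. exp (y \<bullet> x) * (y \<bullet> h))" for x h
    using Z[of x] by (simp add: G_def w_def inner_sum_left sum_distrib_left)
  then have dZ: "(Z has_derivative (\<lambda>h. Z x * (G x \<bullet> h))) (at x)" for x
    unfolding Z_def[abs_def] by (simp add: Z_def) (intro has_derivative_sum dexp)
  have dw: "(w y has_derivative (\<lambda>h. w y x * ((y - G x) \<bullet> h))) (at x)" for y x
  proof -
    have "((\<lambda>x. exp (y \<bullet> x) / Z x) has_derivative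
        (\<lambda>h. (exp (y \<bullet> x) * (y \<bullet> h) * Z x - exp (y \<bullet> x) * (Z x * (G x \<bullet> h))) / (Z x * Z x))) (at x)"
      using Z[of x] by (intro has_derivative_divide' dexp dZ) auto
    moreover have "(exp (y \<bullet> x) * (y \<bullet> h) * Z x - exp (y \<bullet> x) * (Z x * (G x \<bullet> h))) / (Z x * Z x)
        = w y x * ((y - G x) \<bullet> h)" for h
      using Z[of x] by (simp add: w_def inner_diff_left field_simps)
    ultimately show ?thesis unfolding w_def[abs_def] by simp
  qed
  have df: "((\<lambda>x. ln (Z x)) has_derivative (\<lambda>h. G x \<bullet> h)) (at x)" for x
  proof -
    have "((\<lambda>x. ln (Z x)) has_derivative (\<lambda>h. Z x * (G x \<bullet> h) * inverse (Z x))) (at x)"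
      using has_derivative_ln[OF Z dZ] .
    moreover have "(\<lambda>h. Z x * (G x \<bullet> h) * inverse (Z x)) = (\<lambda>h. G x \<bullet> h)"
      using Z[of x] by (simp add: fun_eq_iff)
    ultimately show ?thesis by simp
  qed
  have dG: "(G has_derivative D x) (at x)" for x
    unfolding G_def[abs_def] D_def[abs_def] by (intro has_derivative_sum has_derivative_scaleR_left) (use dw in \<open>simp add: G_def\<close>)
  have lin: "linear (D x)" for x
    using dG has_derivative_linear by blast
  have GS: "G x \<in> convex hull S" for x
  proof -
    have "(\<forall>y\<in>S. 0 \<le> w y x) \<and> sum (\<lambda>y. w y x) S = 1 \<and> (\<Sum>y\<in>S. w y x *\<^sub>R y) = G x"
      using sw less_imp_le[OF w] by (simp add: G_def)
    then show ?thesis unfolding convex_hull_finite[OF S(1)] by (intro CollectI exI[of _ "\<lambda>y. w y x"])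
  qed
  have ge: "q \<bullet> x \<le> ln (Z x)" if q: "q \<in> convex hull S" for q x
  proof -
    have "S \<subseteq> {q. x \<bullet> q \<le> ln (Z x)}"
    proof
      fix y assume "y \<in> S"
      then have "exp (y \<bullet> x) \<le> Z x"
        unfolding Z_def using S by (intro member_le_sum) auto
      then show "y \<in> {q. x \<bullet> q \<le> ln (Z x)}" using Z[of x] by (simp add: ln_ge_iff inner_commute)
    qed
    then have "convex hull S \<subseteq> {q. x \<bullet> q \<le> ln (Z x)}"
      by (intro hull_minimal convex_halfspace_le)
    then show ?thesis using q by (auto simp: inner_commute)
  qed
  have pos: "h \<bullet> D x h > 0" if "h \<noteq> 0" for x h
  proof -
    \<comment> \<open>Deviations from the mean average to zero; this turns the expression for
      \<open>h \<bullet> D x h\<close> into a sum of squares.\<close>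
    have "(\<Sum>y\<in>S. w y x * ((y - G x) \<bullet> h)) = (\<Sum>y\<in>S. w y x * (y \<bullet> h)) - (\<Sum>y\<in>S. w y x) * (G x \<bullet> h)"
      by (simp add: inner_diff_left right_diff_distrib sum_subtractf sum_distrib_right)
    also have "\<dots> = 0" by (simp add: sw) (simp add: G_def inner_sum_left)
    finally have z: "(\<Sum>y\<in>S. w y x * ((y - G x) \<bullet> h)) = 0" .
    have "h \<bullet> D x h = (\<Sum>y\<in>S. w y x * ((y - G x) \<bullet> h) * (y \<bullet> h))"
      by (simp add: D_def inner_sum_right inner_commute)
    also have "\<dots> = (\<Sum>y\<in>S. w y x * ((y - G x) \<bullet> h)\<^sup>2) + (\<Sum>y\<in>S. w y x * ((y - G x) \<bullet> h)) * (G x \<bullet> h)"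
      unfolding sum_distrib_right sum.distrib[symmetric]
      by (intro sum.cong refl) (simp add: power2_eq_square inner_diff_left algebra_simps)
    finally have eq: "h \<bullet> D x h = (\<Sum>y\<in>S. w y x * ((y - G x) \<bullet> h)\<^sup>2)" using z by simp
    have "\<exists>y\<in>S. (y - G x) \<bullet> h \<noteq> 0"
    proof (rule ccontr)
      assume "\<not> (\<exists>y\<in>S. (y - G x) \<bullet> h \<noteq> 0)"
      then have "S \<subseteq> {y. h \<bullet> y = h \<bullet> G x}" by (auto simp: inner_diff_left inner_diff_right inner_commute)
      then have "convex hull S \<subseteq> {y. h \<bullet> y = h \<bullet> G x}" by (intro hull_minimal convex_hyperplane)
      then have "interior (convex hull S) \<subseteq> interior {y. h \<bullet> y = h \<bullet> G x}" by (rule interior_mono)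
      then show False using S(2) that by simp
    qed
    then obtain y where y: "y \<in> S" "(y - G x) \<bullet> h \<noteq> 0" by blast
    show ?thesis unfolding eq
      by (rule sum_pos2[OF S(1) y(1)]) (use y w less_imp_le[OF w] in auto)
  qed
  have "gradient_body (convex hull S) (\<lambda>x. matrix (D x))"
    unfolding gradient_body_def
    by (intro exI[of _ "\<lambda>x. ln (Z x)"] exI[of _ G]) (use df dG GS ge pos lin in auto)
  then show ?thesis by (rule exI[of _ "\<lambda>x. matrix (D x)"])
qed

text \<open>Polytopes admit smooth potentials; general bodies are reached from inside by polytopes.\<close>

definition exhausted_body :: "(real^'n) set \<Rightarrow> (nat \<Rightarrow> real^'n \<Rightarrow> real^'n^'n) \<Rightarrow> bool" where
  "exhausted_body K M \<longleftrightarrow> compact K \<and> (\<exists>P. incseq P \<and> K = closure (\<Union>j. P j) \<and>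
     (\<forall>j. compact (P j) \<and> convex (P j) \<and> gradient_body (P j) (M j)))"

lemma exhausted_body_zero: "exhausted_body {0} (\<lambda>_ _. 0)"
  unfolding exhausted_body_def
  by (intro conjI exI[of _ "\<lambda>_. {0}"]) (auto simp: gradient_body_zero)

lemma exhausted_body_scaleR:
  assumes "exhausted_body K M" "t \<ge> 0"
  shows "exhausted_body ((*\<^sub>R) t ` K) (\<lambda>j x. t *\<^sub>R M j x)"
proof -
  obtain P where P: "compact K" "incseq P" "K = closure (\<Union>j. P j)"
    "\<And>j. compact (P j)" "\<And>j. convex (P j)" "\<And>j. gradient_body (P j) (M j)"
    using assms unfolding exhausted_body_def by blast
  show ?thesis
    unfolding exhausted_body_def
  proof (intro conjI exI[of _ "\<lambda>j. (*\<^sub>R) t ` P j"] allI)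
    show "compact ((*\<^sub>R) t ` K)" using P(1) by (rule compact_scaling)
    show "incseq (\<lambda>j. (*\<^sub>R) t ` P j)" using P(2) by (auto simp: incseq_def)
    show "(*\<^sub>R) t ` K = closure (\<Union>j. (*\<^sub>R) t ` P j)"
      using closure_scaleR[of t "\<Union>j. P j"] P(3) by (simp add: image_UN)
    show "compact ((*\<^sub>R) t ` P j)" "convex ((*\<^sub>R) t ` P j)" for j
      using P by (auto intro: compact_scaling convex_scaling)
    show "gradient_body ((*\<^sub>R) t ` P j) (\<lambda>x. t *\<^sub>R M j x)" for j
      using P(6) assms(2) by (rule gradient_body_scaleR)
  qed
qed

lemma compact_set_plus:
  fixes A B :: "'a::real_normed_vector set"
  assumes "compact A" "compact B"
  shows "compact (A + B)"
proof -
  have "A + B = {x + y | x y. x \<in> A \<and> y \<in> B}" by (auto simp: set_plus_def)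
  then show ?thesis using compact_sums[OF assms] by simp
qed

text \<open>Both exhaustions increase, so points from different stages lie in a common one.
  Compactness makes \<open>K + L\<close> closed, which a sum of closed sets need not be.\<close>

lemma exhausted_body_add:
  assumes "exhausted_body K M" "exhausted_body L N"
  shows "exhausted_body (K + L) (\<lambda>j x. M j x + N j x)"
proof -
  obtain P where P: "compact K" "incseq P" "K = closure (\<Union>j. P j)"
    "\<And>j. compact (P j)" "\<And>j. convex (P j)" "\<And>j. gradient_body (P j) (M j)"
    using assms(1) unfolding exhausted_body_def by blast
  obtain Q where Q: "compact L" "incseq Q" "L = closure (\<Union>j. Q j)"
    "\<And>j. compact (Q j)" "\<And>j. convex (Q j)" "\<And>j. gradient_body (Q j) (N j)"
    using assms(2) unfolding exhausted_body_def by blast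
  show ?thesis
    unfolding exhausted_body_def
  proof (intro conjI exI[of _ "\<lambda>j. P j + Q j"] allI)
    show c: "compact (K + L)" by (rule compact_set_plus[OF P(1) Q(1)])
    show "incseq (\<lambda>j. P j + Q j)" using P(2) Q(2) by (simp add: incseq_def set_plus_mono2)
    have un: "(\<Union>j. P j + Q j) = (\<Union>j. P j) + (\<Union>j. Q j)"
    proof
      show "(\<Union>j. P j) + (\<Union>j. Q j) \<subseteq> (\<Union>j. P j + Q j)"
      proof
        fix z assume "z \<in> (\<Union>j. P j) + (\<Union>j. Q j)"
        then obtain a b i j where z: "z = a + b" "a \<in> P i" "b \<in> Q j" by (auto elim!: set_plus_elim)
        then have "a \<in> P (max i j)" "b \<in> Q (max i j)"
          using incseqD[OF P(2), of i "max i j"] incseqD[OF Q(2), of j "max i j"] by auto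
        then show "z \<in> (\<Union>j. P j + Q j)" using z by (auto intro: set_plus_intro)
      qed
    qed (auto elim!: set_plus_elim intro: set_plus_intro)
    show "K + L = closure (\<Union>j. P j + Q j)"
    proof
      show "K + L \<subseteq> closure (\<Union>j. P j + Q j)" unfolding un P(3) Q(3) by (rule closure_sum)
      have "(\<Union>j. P j) + (\<Union>j. Q j) \<subseteq> K + L"
        unfolding P(3) Q(3) by (intro set_plus_mono2 closure_subset)
      then show "closure (\<Union>j. P j + Q j) \<subseteq> K + L"
        unfolding un by (intro closure_minimal compact_imp_closed[OF c])
    qed
    show "compact (P j + Q j)" for j by (rule compact_set_plus[OF P(4) Q(4)])
    show "convex (P j + Q j)" for j by (rule convex_set_plus[OF P(5) Q(5)])
    show "gradient_body (P j + Q j) (\<lambda>x. M j x + N j x)" for j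
      using P(6) Q(6) by (rule gradient_body_add)
  qed
qed

lemma exhausted_body_sum:
  assumes "finite I" "\<And>i. i \<in> I \<Longrightarrow> exhausted_body (K i) (M i)"
  shows "exhausted_body (\<Sum>i\<in>I. K i) (\<lambda>j x. \<Sum>i\<in>I. M i j x)"
  using assms
  by (induction I rule: finite_induct) (auto simp: set_zero exhausted_body_zero exhausted_body_add)

text \<open>The limit body gets no potential of its own; only the integrals converge. The increasing
  union is convex, so \<open>K\<close> differs from it within a null frontier, and measure is
  continuous along the union.\<close>

lemma exhausted_body_det_limit:
  assumes "exhausted_body K M"
  shows "\<exists>I. (\<forall>j. ((\<lambda>x. det (M j x)) has_integral I j) UNIV) \<and> I \<longlonglongrightarrow> measure lebesgue K"
proof -
  obtain P where P: "compact K" "incseq P" "K = closure (\<Union>j. P j)"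
    "\<And>j. compact (P j)" "\<And>j. convex (P j)" "\<And>j. gradient_body (P j) (M j)"
    using assms unfolding exhausted_body_def by blast
  let ?U = "\<Union>j. P j"
  have U: "convex ?U"
  proof (rule convexI)
    fix a b and u v :: real assume ab: "a \<in> ?U" "b \<in> ?U" "u \<ge> 0" "v \<ge> 0" "u + v = 1"
    then obtain i j where "a \<in> P i" "b \<in> P j" by auto
    then have "a \<in> P (max i j)" "b \<in> P (max i j)"
      using incseqD[OF P(2), of i "max i j"] incseqD[OF P(2), of j "max i j"] by auto
    then show "u *\<^sub>R a + v *\<^sub>R b \<in> ?U" using convexD[OF P(5)] ab by blast
  qed
  have "bounded ?U" using P(1) closure_subset[of ?U] unfolding P(3) by (meson bounded_subset compact_imp_bounded)
  then have Um: "?U \<in> lmeasurable" using U by (intro measurable_convex)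
  have "K - ?U \<union> (?U - K) \<subseteq> frontier ?U"
    using closure_subset[of ?U] interior_subset[of ?U] unfolding P(3) frontier_def by blast
  then have n: "negligible (?U - K \<union> (K - ?U))"
    using negligible_convex_frontier[OF U] negligible_subset by (metis sup_commute)
  have "measure lebesgue K = measure lebesgue ?U"
    by (rule measure_negligible_symdiff[OF Um n])
  moreover have "(\<lambda>j. measure lebesgue (P j)) \<longlonglongrightarrow> measure lebesgue ?U"
  proof (rule Lim_measure_incseq)
    show "range P \<subseteq> sets lebesgue" using P(4) by (auto intro: lmeasurable_compact fmeasurableD)
    show "emeasure lebesgue ?U \<noteq> \<infinity>" using fmeasurableD2[OF Um] unfolding infinity_ennreal_def .
  qed (rule P(2))
  ultimately show ?thesis
    using has_integral_det_gradient_body[OF P(6) P(4) P(5)] by (intro exI[of _ "\<lambda>j. measure lebesgue (P j)"]) auto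
qed

text \<open>The stages are hulls of finitely many points. A fixed set \<open>F\<close> spanning a
  box inside \<open>K\<close> gives every stage interior points, and an enumeration of a countable
  dense subset \<open>D\<close> makes the union dense.\<close>

lemma convex_body_exhausted:
  fixes K :: "(real^'n) set"
  assumes "convex_body K"
  shows "\<exists>M. exhausted_body K M"
proof -
  have K: "compact K" "convex K" "interior K \<noteq> {}" using assms by (auto simp: convex_body_def)
  obtain F where F: "finite F" "F \<subseteq> K" "interior (convex hull F) \<noteq> {}"
  proof -
    obtain x where x: "x \<in> interior K" using K(3) by blast
    obtain a b where ab: "cbox a b \<subseteq> interior K" "x \<in> box a b"
      using open_contains_cbox[OF open_interior x] by metis
    obtain F where "finite F" "cbox a b = convex hull F"
      by (rule closed_interval_as_convex_hull)
    moreover have "interior (cbox a b) \<noteq> {}" using ab(2) by (auto simp: interior_cbox)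
    moreover have "F \<subseteq> convex hull F" by (rule hull_subset)
    ultimately show ?thesis using that[of F] ab(1) interior_subset[of K] by auto
  qed
  obtain D where D: "countable D" "D \<subseteq> K" "K \<subseteq> closure D"
    using separable[of K] by blast
  have "D \<noteq> {}" using D K(3) interior_subset[of K] by fastforce
  define d where "d = from_nat_into D"
  have d: "range d = D" unfolding d_def using D(1) \<open>D \<noteq> {}\<close> by (rule range_from_nat_into[rotated])
  define P where "P j = convex hull (F \<union> d ` {..<j})" for j
  have "\<exists>M. gradient_body (P j) M" for j
  proof -
    have "convex hull F \<subseteq> P j" unfolding P_def by (intro hull_mono) auto
    then have "interior (convex hull (F \<union> d ` {..<j})) \<noteq> {}"
      using F(3) interior_mono unfolding P_def by blast
    then show ?thesis
      unfolding P_def using F(1) by (intro gradient_body_polytope) auto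
  qed
  then have "gradient_body (P j) (SOME M. gradient_body (P j) M)" for j by (rule someI_ex)
  moreover have "incseq P" unfolding incseq_def P_def by (auto intro!: hull_mono)
  moreover have "K = closure (\<Union>j. P j)"
  proof
    have "D \<subseteq> (\<Union>j. P j)"
    proof
      fix y assume "y \<in> D"
      then obtain j where "y = d j" using d by auto
      then have "y \<in> P (Suc j)" unfolding P_def by (intro hull_inc) auto
      then show "y \<in> (\<Union>j. P j)" by blast
    qed
    then show "K \<subseteq> closure (\<Union>j. P j)" using D(3) closure_mono by blast
    have "P j \<subseteq> K" for j unfolding P_def using F(2) D(2) d K(2) by (intro hull_minimal) auto
    then show "closure (\<Union>j. P j) \<subseteq> K" using K(1) by (intro closure_minimal compact_imp_closed) auto
  qed
  moreover have "compact (P j)" "convex (P j)" for j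
    unfolding P_def using F(1) by (auto intro!: finite_imp_compact_convex_hull)
  ultimately show ?thesis
    unfolding exhausted_body_def using K(1)
    by (intro exI[of _ "\<lambda>j. SOME M. gradient_body (P j) M"] conjI exI[of _ P]) auto
qed

section \<open>Multilinearity of the polarized volume\<close>

text \<open>
  Besides convex bodies this covers the point \<open>{0}\<close>, which occurs as a Minkowski sum with all
  coefficients zero.
\<close>

definition exhaustible :: "(real^'n) set \<Rightarrow> bool" where
  "exhaustible K \<longleftrightarrow> (\<exists>M. exhausted_body K M)"

lemma exhaustible_convex_body: "convex_body K \<Longrightarrow> exhaustible K"
  by (simp add: exhaustible_def convex_body_exhausted)

lemma exhaustible_scaleR: "exhaustible K \<Longrightarrow> t \<ge> 0 \<Longrightarrow> exhaustible ((*\<^sub>R) t ` K)"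
  unfolding exhaustible_def using exhausted_body_scaleR by blast

lemma exhaustible_add: "exhaustible K \<Longrightarrow> exhaustible L \<Longrightarrow> exhaustible (K + L)"
  unfolding exhaustible_def using exhausted_body_add by blast

lemma exhaustible_sum: "finite I \<Longrightarrow> (\<And>i. i \<in> I \<Longrightarrow> exhaustible (K i)) \<Longrightarrow> exhaustible (\<Sum>i\<in>I. K i)"
proof (induction I rule: finite_induct)
  case empty
  then show ?case unfolding exhaustible_def using exhausted_body_zero by (auto simp: set_zero)
qed (auto simp: exhaustible_add)

lemma exhaustible_nonempty: "exhaustible K \<Longrightarrow> K \<noteq> {}"
  unfolding exhaustible_def exhausted_body_def gradient_body_def
  by (metis UN_I UNIV_I closure_subset empty_iff subsetD)

text \<open>The same functions \<open>M i\<close> serve the Minkowski sums over all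
  \<open>S\<close>, so the integrands recombine pointwise into the polarization of
  \<open>det\<close>; a finite signed sum commutes with integrals and limits.\<close>

lemma polarization_measure_limit:
  assumes "\<And>i. i < n \<Longrightarrow> exhausted_body (L i) (M i)"
  shows "\<exists>I. (\<forall>j. ((\<lambda>x. polarization n det (\<lambda>i. M i j x)) has_integral I j) UNIV) \<and>
    I \<longlonglongrightarrow> polarization n (measure lebesgue) L"
proof -
  have "\<forall>S\<in>Pow {..<n}. \<exists>I. (\<forall>j. ((\<lambda>x. det (\<Sum>i\<in>S. M i j x)) has_integral I j) UNIV) \<and>
      I \<longlonglongrightarrow> measure lebesgue (\<Sum>i\<in>S. L i)"
  proof
    fix S assume "S \<in> Pow {..<n}"
    then have "exhausted_body (\<Sum>i\<in>S. L i) (\<lambda>j x. \<Sum>i\<in>S. M i j x)"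
      by (intro exhausted_body_sum) (auto intro: finite_subset assms)
    then show "\<exists>I. (\<forall>j. ((\<lambda>x. det (\<Sum>i\<in>S. M i j x)) has_integral I j) UNIV) \<and>
      I \<longlonglongrightarrow> measure lebesgue (\<Sum>i\<in>S. L i)"
      by (rule exhausted_body_det_limit)
  qed
  then obtain J where J: "\<And>S j. S \<in> Pow {..<n} \<Longrightarrow> ((\<lambda>x. det (\<Sum>i\<in>S. M i j x)) has_integral J S j) UNIV"
    "\<And>S. S \<in> Pow {..<n} \<Longrightarrow> J S \<longlonglongrightarrow> measure lebesgue (\<Sum>i\<in>S. L i)"
    by metis
  show ?thesis
  proof (intro exI conjI allI)
    show "((\<lambda>x. polarization n det (\<lambda>i. M i j x)) has_integral
        (\<Sum>S\<in>Pow {..<n}. (-1) ^ card ({..<n} - S) * J S j) / fact n) UNIV" for j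
      unfolding polarization_def
      by (intro has_integral_divide has_integral_sum has_integral_mult_right J) auto
    show "(\<lambda>j. (\<Sum>S\<in>Pow {..<n}. (-1) ^ card ({..<n} - S) * J S j) / fact n)
        \<longlonglongrightarrow> polarization n (measure lebesgue) L"
      unfolding polarization_def by (intro tendsto_intros J) auto
  qed
qed

lemma polarization_measure_linear:
  fixes L :: "nat \<Rightarrow> (real^'n) set"
  assumes L: "\<And>i. i < CARD('n) \<Longrightarrow> i \<noteq> k \<Longrightarrow> exhaustible (L i)" and k: "k < CARD('n)"
    and XY: "exhaustible X" "exhaustible Y" and ab: "a \<ge> 0" "b \<ge> 0"
  shows "polarization CARD('n) (measure lebesgue) (L(k := (*\<^sub>R) a ` X + (*\<^sub>R) b ` Y)) =
    a * polarization CARD('n) (measure lebesgue) (L(k := X)) +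
    b * polarization CARD('n) (measure lebesgue) (L(k := Y))"
proof -
  obtain M where M: "\<And>i. i < CARD('n) \<Longrightarrow> i \<noteq> k \<Longrightarrow> exhausted_body (L i) (M i)"
    using L unfolding exhaustible_def by metis
  obtain A B where A: "exhausted_body X A" and B: "exhausted_body Y B"
    using XY unfolding exhaustible_def by blast
  \<comment> \<open>The combination is exhausted with the combined Hessians, so the determinant
    identity already holds at each stage \<open>j\<close>.\<close>
  define C where "C j x = a *\<^sub>R A j x + b *\<^sub>R B j x" for j x
  have C: "exhausted_body ((*\<^sub>R) a ` X + (*\<^sub>R) b ` Y) C"
    unfolding C_def by (intro exhausted_body_add exhausted_body_scaleR A B ab)
  have upd: "exhausted_body ((L(k := Z)) i) ((M(k := N)) i)"
    if "exhausted_body Z N" "i < CARD('n)" for Z N i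
    using that M by auto
  have eq: "(\<lambda>i. (M(k := N)) i j x) = (\<lambda>i. M i j x)(k := N j x)" for N j x by auto
  let ?p = "\<lambda>N j x. polarization CARD('n) det ((\<lambda>i. M i j x)(k := N j x))"
  have lim: "\<exists>I. (\<forall>j. (?p N j has_integral I j) UNIV) \<and>
      I \<longlonglongrightarrow> polarization CARD('n) (measure lebesgue) (L(k := Z))"
    if "exhausted_body Z N" for Z N
    using polarization_measure_limit[of "CARD('n)" "L(k := Z)" "M(k := N)"] upd[OF that]
    unfolding eq by blast
  obtain I1 where I1: "\<And>j. (?p A j has_integral I1 j) UNIV"
    "I1 \<longlonglongrightarrow> polarization CARD('n) (measure lebesgue) (L(k := X))" using lim[OF A] by blast
  obtain I2 where I2: "\<And>j. (?p B j has_integral I2 j) UNIV"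
    "I2 \<longlonglongrightarrow> polarization CARD('n) (measure lebesgue) (L(k := Y))" using lim[OF B] by blast
  obtain I3 where I3: "\<And>j. (?p C j has_integral I3 j) UNIV"
    "I3 \<longlonglongrightarrow> polarization CARD('n) (measure lebesgue) (L(k := (*\<^sub>R) a ` X + (*\<^sub>R) b ` Y))"
    using lim[OF C] by blast
  have "?p C j = (\<lambda>x. a * ?p A j x + b * ?p B j x)" for j
    unfolding C_def using polarization_det_linear[OF k] by blast
  then have "(?p C j has_integral a * I1 j + b * I2 j) UNIV" for j
    using has_integral_add[OF has_integral_mult_right[OF I1(1), of a] has_integral_mult_right[OF I2(1), of b]]
    by simp
  then have "I3 = (\<lambda>j. a * I1 j + b * I2 j)"
    using has_integral_unique I3(1) by blast
  moreover have "(\<lambda>j. a * I1 j + b * I2 j) \<longlonglongrightarrow> a * polarization CARD('n) (measure lebesgue) (L(k := X)) +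
    b * polarization CARD('n) (measure lebesgue) (L(k := Y))"
    by (intro tendsto_intros I1 I2)
  ultimately show ?thesis using I3(2) LIMSEQ_unique by blast
qed

text \<open>By \<open>polarization_det_same\<close> the integrals that tend to the two sides have
  the same integrands.\<close>

lemma polarization_measure_same:
  fixes K :: "(real^'n) set"
  assumes "exhaustible K"
  shows "polarization CARD('n) (measure lebesgue) (\<lambda>_. K) = measure lebesgue K"
proof -
  obtain M where M: "exhausted_body K M" using assms unfolding exhaustible_def by blast
  have "polarization CARD('n) det (\<lambda>i. M j x) = det (M j x)" for j x
    by (rule polarization_det_same)
  then obtain I where I: "\<And>j. ((\<lambda>x. det (M j x)) has_integral I j) UNIV"
    "I \<longlonglongrightarrow> polarization CARD('n) (measure lebesgue) (\<lambda>_. K)"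
    using polarization_measure_limit[of "CARD('n)" "\<lambda>_. K" "\<lambda>_. M", OF M] by auto
  obtain I' where I': "\<And>j. ((\<lambda>x. det (M j x)) has_integral I' j) UNIV"
    "I' \<longlonglongrightarrow> measure lebesgue K"
    using exhausted_body_det_limit[OF M] by blast
  have "I = I'" using I(1) I'(1) has_integral_unique by blast
  then show ?thesis using I(2) I'(2) LIMSEQ_unique by blast
qed

lemma polarization_permute:
  assumes p: "p permutes {..<n}"
  shows "polarization n F (\<lambda>i. A (p i)) = polarization n F A"
proof -
  have "(\<Sum>S\<in>Pow {..<n}. (-1) ^ card ({..<n} - S) * F (\<Sum>i\<in>S. A (p i))) =
      (\<Sum>S\<in>Pow {..<n}. (-1) ^ card ({..<n} - p ` S) * F (\<Sum>i\<in>p ` S. A i))"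
  proof (intro sum.cong refl)
    fix S assume "S \<in> Pow {..<n}"
    have "p ` ({..<n} - S) = {..<n} - p ` S"
      using p by (simp add: image_set_diff permutes_inj permutes_image)
    then have "card ({..<n} - S) = card ({..<n} - p ` S)"
      by (metis card_image inj_on_subset p permutes_inj subset_UNIV)
    then show "(-1) ^ card ({..<n} - S) * F (\<Sum>i\<in>S. A (p i)) =
        (-1) ^ card ({..<n} - p ` S) * F (\<Sum>i\<in>p ` S. A i)"
      using sum.reindex[of p S A] permutes_inj[OF p] by (simp add: inj_on_subset)
  qed
  also have "\<dots> = (\<Sum>S\<in>Pow {..<n}. (-1) ^ card ({..<n} - S) * F (\<Sum>i\<in>S. A i))"
    by (rule sum.reindex_bij_betw) (intro bij_betw_Pow permutes_imp_bij p)
  finally show ?thesis by (simp add: polarization_def)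
qed

definition volume_polarization :: "'a::euclidean_space set list \<Rightarrow> real" where
  "volume_polarization Ks = polarization (length Ks) (measure lebesgue) (\<lambda>i. Ks ! i)"

lemma polarization_cong:
  "(\<And>i. i < n \<Longrightarrow> A i = B i) \<Longrightarrow> polarization n F A = polarization n F B"
  unfolding polarization_def by (intro arg_cong2[of _ _ _ _ "(/)"] sum.cong refl arg_cong2[of _ _ _ _ "(*)"] arg_cong[of _ _ F]) auto

lemma volume_polarization_mset:
  assumes "mset Ks = mset Ls"
  shows "volume_polarization Ks = volume_polarization Ls"
proof -
  obtain p where p: "p permutes {..<length Ls}" "permute_list p Ls = Ks"
    using mset_eq_permutation[OF assms] .
  have "volume_polarization Ks = polarization (length Ls) (measure lebesgue) (\<lambda>i. Ls ! p i)"
    unfolding volume_polarization_def using p by (auto intro!: polarization_cong simp: permute_list_nth)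
  then show ?thesis unfolding volume_polarization_def using polarization_permute[OF p(1)] by simp
qed

lemma volume_polarization_linear:
  fixes X :: "(real^'n) set"
  assumes "length Ks + 1 = CARD('n)" "\<forall>K\<in>set Ks. exhaustible K"
    and "exhaustible X" "exhaustible Y" "a \<ge> 0" "b \<ge> 0"
  shows "volume_polarization (((*\<^sub>R) a ` X + (*\<^sub>R) b ` Y) # Ks) =
    a * volume_polarization (X # Ks) + b * volume_polarization (Y # Ks)"
proof -
  have eq: "volume_polarization (Z # Ks) = polarization CARD('n) (measure lebesgue) ((\<lambda>i. (Z # Ks) ! i)(0 := Z))" for Z
    unfolding volume_polarization_def using assms(1) by (simp, intro polarization_cong) auto
  \<comment> \<open>Makes the updated function independent of \<open>Z\<close>, as
    \<open>polarization_measure_linear\<close> requires.\<close>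
  have eq': "(\<lambda>i. (Z # Ks) ! i)(0 := Z) = (\<lambda>i. Ks ! (i - 1))(0 := Z)" for Z
    by (auto simp: fun_eq_iff nth_Cons')
  show ?thesis unfolding eq eq'
    by (rule polarization_measure_linear) (use assms in auto)
qed

lemma volume_polarization_replicate:
  fixes K :: "(real^'n) set"
  assumes "exhaustible K"
  shows "volume_polarization (replicate CARD('n) K) = measure lebesgue K"
  using polarization_measure_same[OF assms] polarization_cong[of "CARD('n)" "\<lambda>i. replicate CARD('n) K ! i" "\<lambda>_. K"]
  unfolding volume_polarization_def by simp

section \<open>Binomial expansion and iterated one-sided derivatives\<close>

text \<open>Stated for an abstract symmetric functional because it is applied both to bodies, when
  derivatives are taken, and to functions, along the reflection path. One copy of \<open>X\<close>
  is split off and Pascal's rule recombines the two expansions.\<close>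

lemma binomial_multilinear:
  fixes F :: "'a list \<Rightarrow> real"
  assumes sym: "\<And>xs ys. set xs \<subseteq> D \<Longrightarrow> length xs = n \<Longrightarrow> mset xs = mset ys \<Longrightarrow> F xs = F ys"
    and D: "X \<in> D" "E \<in> D" "Q \<in> D"
    and lin: "\<And>xs. set xs \<subseteq> D \<Longrightarrow> length xs + 1 = n \<Longrightarrow> F (X # xs) = F (E # xs) + t * F (Q # xs)"
  shows "set rest \<subseteq> D \<Longrightarrow> k + length rest = n \<Longrightarrow>
    F (replicate k X @ rest) =
    (\<Sum>j\<le>k. real (k choose j) * t ^ j * F (replicate (k - j) E @ replicate j Q @ rest))"
proof (induction k arbitrary: rest)
  case (Suc k)
  let ?a = "\<lambda>j. F (replicate (Suc k - j) E @ replicate j Q @ rest)"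
  have *: "F (replicate k X @ Z # rest) = (\<Sum>j\<le>k. real (k choose j) * t ^ j *
      F (replicate (k - j) E @ replicate j Q @ Z # rest))" if "Z \<in> D" for Z
    using Suc.prems that by (intro Suc.IH) auto
  have r: "set (replicate m Z) \<subseteq> D" if "Z \<in> D" for m Z using that by auto
  have s: "F (Z # replicate k X @ rest) = F (replicate k X @ Z # rest)" if "Z \<in> D" for Z
    using Suc.prems D that by (intro sym) auto
  have E: "F (replicate (k - j) E @ replicate j Q @ E # rest) = ?a j" if "j \<le> k" for j
    using Suc.prems D that by (intro sym) (auto simp: Suc_diff_le)
  have Q: "F (replicate (k - j) E @ replicate j Q @ Q # rest) = ?a (Suc j)" if "j \<le> k" for j
    using Suc.prems D that by (intro sym) auto
  have "F (replicate (Suc k) X @ rest) = F (replicate k X @ E # rest) + t * F (replicate k X @ Q # rest)"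
    using lin[of "replicate k X @ rest"] Suc.prems D s r by auto
  also have "\<dots> = (\<Sum>j\<le>k. real (k choose j) * t ^ j * ?a j) + t * (\<Sum>j\<le>k. real (k choose j) * t ^ j * ?a (Suc j))"
    unfolding *[OF D(2)] *[OF D(3)] using E Q by simp
  also have "\<dots> = ?a 0 + ((\<Sum>j\<le>k. real (k choose Suc j) * t ^ Suc j * ?a (Suc j)) +
      (\<Sum>j\<le>k. real (k choose j) * t ^ Suc j * ?a (Suc j)))"
  proof -
    \<comment> \<open>The added term has coefficient \<open>k choose Suc k = 0\<close>; it gives the
      sum the length needed for the index shift.\<close>
    have "(\<Sum>j\<le>k. real (k choose j) * t ^ j * ?a j) = (\<Sum>j\<le>Suc k. real (k choose j) * t ^ j * ?a j)"
      by (simp add: binomial_eq_0)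
    also have "\<dots> = ?a 0 + (\<Sum>j\<le>k. real (k choose Suc j) * t ^ Suc j * ?a (Suc j))"
      by (subst sum.atMost_Suc_shift) simp
    finally show ?thesis by (simp add: sum_distrib_left mult_ac)
  qed
  also have "\<dots> = ?a 0 + (\<Sum>j\<le>k. real (Suc k choose Suc j) * t ^ Suc j * ?a (Suc j))"
    by (simp add: sum.distrib[symmetric] algebra_simps)
  also have "\<dots> = (\<Sum>j\<le>Suc k. real (Suc k choose j) * t ^ j * ?a j)"
    by (subst sum.atMost_Suc_shift) simp
  finally show ?case .
qed simp

text \<open>Nontriviality of this filter makes the one-sided derivative unique, so that
  \<open>vector_derivative\<close> can be evaluated.\<close>

lemma at_right_0_within: "at (0::real) within {0..} \<noteq> bot"
proof -
  have "at_right (0::real) \<le> at 0 within {0..}" by (intro at_le) auto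
  then show ?thesis using trivial_limit_at_right_real[of 0] by (metis bot.extremum_uniqueI)
qed

text \<open>The upper limit \<open>Suc k\<close> guarantees that the linear coefficient is among the
  summands.\<close>

lemma vector_derivative_polynomial_at_0:
  fixes c :: "nat \<Rightarrow> real"
  assumes "\<And>s. s \<ge> 0 \<Longrightarrow> f s = (\<Sum>j\<le>Suc k. c j * s ^ j)"
  shows "vector_derivative f (at 0 within {0..}) = c 1"
proof (rule vector_derivative_within[OF at_right_0_within])
  have "((\<lambda>s. \<Sum>j\<le>Suc k. c j * s ^ j) has_real_derivative (\<Sum>j\<le>Suc k. c j * (real j * 0 ^ (j - 1)))) (at 0 within {0..})"
  proof (rule DERIV_sum)
    show "((\<lambda>s. c j * s ^ j) has_real_derivative c j * (real j * 0 ^ (j - 1))) (at 0 within {0..})" for j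
      by (auto intro!: derivative_eq_intros)
  qed
  moreover have "(\<Sum>j\<le>Suc k. c j * (real j * 0 ^ (j - 1))) = c 1"
  proof -
    have "(\<Sum>j\<le>Suc k. c j * (real j * 0 ^ (j - 1))) = (\<Sum>j\<le>Suc k. if j = 1 then c 1 else 0)"
      by (intro sum.cong refl) (auto simp: power_0_left)
    then show ?thesis by simp
  qed
  ultimately have "((\<lambda>s. \<Sum>j\<le>Suc k. c j * s ^ j) has_vector_derivative c 1) (at 0 within {0..})"
    by (simp add: has_real_derivative_iff_has_vector_derivative)
  then show "(f has_vector_derivative c 1) (at 0 within {0..})"
    by (rule has_vector_derivative_transform[rotated 2]) (use assms in auto)
qed

text \<open>
  Taking the derivatives one at a time, from the last variable on, leaves after the derivatives with
  respect to \<open>t\<^sub>k, \<dots>, t\<^sub>n\<^sub>-\<^sub>1\<close> a multiple of the polarized volume of \<open>k\<close> copies of \<open>\<Sum> t\<^sub>i K\<^sub>i\<close> and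
  the bodies \<open>K\<^sub>k, \<dots>, K\<^sub>n\<^sub>-\<^sub>1\<close>.
\<close>

lemma mixed_volume_eq_polarization:
  fixes Ks :: "(real^'n) set list"
  assumes len: "length Ks = CARD('n)" and ex: "\<forall>K\<in>set Ks. exhaustible K"
  shows "mixed_volume Ks = volume_polarization Ks"
proof -
  let ?n = "CARD('n)"
  define S where "S t = (\<Sum>i<?n. (*\<^sub>R) (t i) ` (Ks ! i))" for t :: "nat \<Rightarrow> real"
  have exS: "exhaustible (S t)" if "\<forall>i. t i \<ge> 0" for t
    unfolding S_def using ex len that by (intro exhaustible_sum exhaustible_scaleR) auto
  \<comment> \<open>Downward induction on \<open>k\<close>: at \<open>k = ?n\<close> nothing has
    been differentiated, and at \<open>k = 0\<close> the remaining factor \<open>fact ?n\<close>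
    cancels the division in \<open>mixed_volume\<close>. The variables from \<open>k\<close> on are
    zero because their derivatives are evaluated there.\<close>
  have "foldr partial_deriv [k..<?n] (volume_combination Ks) t =
      fact ?n / fact k * volume_polarization (replicate k (S t) @ drop k Ks)"
    if "k \<le> ?n" "\<forall>i. t i \<ge> 0" "\<forall>i\<ge>k. t i = 0" for k t
    using that
  proof (induction "?n - k" arbitrary: k t)
    case 0
    then have k: "k = ?n" by simp
    have "volume_combination Ks t = measure lebesgue (S t)"
      by (simp add: volume_combination_def S_def len)
    then show ?case using volume_polarization_replicate[OF exS[OF 0(3)]] by (simp add: k len)
  next
    case (Suc m)
    then have k: "k < ?n" by simp
    let ?X = "Ks ! k" and ?rest = "drop (Suc k) Ks"
    have X: "exhaustible ?X" using ex k len by simp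
    have rest: "\<forall>K\<in>set ?rest. exhaustible K" using ex by (meson in_set_dropD)
    have tk: "t k = 0" using Suc.prems by simp
    have St: "exhaustible (S t)" using Suc.prems by (intro exS) simp
    let ?c = "\<lambda>j. fact ?n / fact (Suc k) * (real (Suc k choose j) *
      volume_polarization (replicate (Suc k - j) (S t) @ replicate j ?X @ ?rest))"
    have "foldr partial_deriv [Suc k..<?n] (volume_combination Ks) (t(k := s)) = (\<Sum>j\<le>Suc k. ?c j * s ^ j)"
      if s: "s \<ge> 0" for s
    proof -
      have Ssplit: "S u = (*\<^sub>R) (u k) ` ?X + (\<Sum>i\<in>{..<?n} - {k}. (*\<^sub>R) (u i) ` (Ks ! i))" for u
        unfolding S_def using k by (intro sum.remove) auto
      have z: "(*\<^sub>R) 0 ` ?X = {0}" using exhaustible_nonempty[OF X] by auto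
      have "S t = (\<Sum>i\<in>{..<?n} - {k}. (*\<^sub>R) (t i) ` (Ks ! i))"
        unfolding Ssplit[of t] tk z by (simp flip: set_zero)
      moreover have "(\<Sum>i\<in>{..<?n} - {k}. (*\<^sub>R) ((t(k := s)) i) ` (Ks ! i)) = (\<Sum>i\<in>{..<?n} - {k}. (*\<^sub>R) (t i) ` (Ks ! i))"
        by (intro sum.cong) auto
      ultimately have Ss: "S (t(k := s)) = (*\<^sub>R) 1 ` S t + (*\<^sub>R) s ` ?X"
        unfolding Ssplit[of "t(k := s)"] by (simp add: add.commute)
      have exs: "exhaustible (S (t(k := s)))" using Suc.prems s by (intro exS) auto
      have "foldr partial_deriv [Suc k..<?n] (volume_combination Ks) (t(k := s)) =
          fact ?n / fact (Suc k) * volume_polarization (replicate (Suc k) (S (t(k := s))) @ ?rest)"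
        using Suc.prems k s Suc.hyps(2) by (intro Suc.hyps(1)) auto
      also have "volume_polarization (replicate (Suc k) (S (t(k := s))) @ ?rest) =
        (\<Sum>j\<le>Suc k. real (Suc k choose j) * s ^ j *
          volume_polarization (replicate (Suc k - j) (S t) @ replicate j ?X @ ?rest))"
      proof (rule binomial_multilinear[where D="Collect exhaustible" and n="?n"])
        show "volume_polarization (S (t(k := s)) # xs) = volume_polarization (S t # xs) + s * volume_polarization (?X # xs)"
          if "set xs \<subseteq> Collect exhaustible" "length xs + 1 = ?n" for xs
          unfolding Ss using volume_polarization_linear[of xs "S t" ?X 1 s] that St X s by auto
      qed (use St X exs rest k len in \<open>auto intro: volume_polarization_mset\<close>)
      finally show ?thesis by (simp only: sum_distrib_left mult_ac)
    qed
    then have "partial_deriv k (foldr partial_deriv [Suc k..<?n] (volume_combination Ks)) t = ?c 1"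
      unfolding partial_deriv_def tk by (rule vector_derivative_polynomial_at_0)
    moreover have "foldr partial_deriv [k..<?n] (volume_combination Ks) t =
        partial_deriv k (foldr partial_deriv [Suc k..<?n] (volume_combination Ks)) t"
      using k by (simp add: upt_conv_Cons)
    moreover have "[?X] @ ?rest = drop k Ks" using k len by (simp add: Cons_nth_drop_Suc)
    \<comment> \<open>The linear coefficient carries \<open>Suc k choose 1 = Suc k\<close>, which
      lowers the factorial in the denominator.\<close>
    moreover have "fact ?n / fact (Suc k) * (real (Suc k) * v) = fact ?n / fact k * v" for v :: real
      by (simp add: field_simps del: of_nat_Suc)
    ultimately show ?case by (simp del: fact_Suc of_nat_Suc)
  qed
  from this[of 0 "\<lambda>_. 0"] show ?thesis by (simp add: mixed_volume_def len)
qed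

section \<open>Support functions\<close>

lemma inner_le_support_fun:
  assumes "compact K" "x \<in> K"
  shows "x \<bullet> u \<le> support_fun K u"
proof -
  have "compact ((\<lambda>x. x \<bullet> u) ` K)" by (intro compact_continuous_image continuous_intros assms)
  then show ?thesis
    unfolding support_fun_def using assms(2)
    by (intro cSUP_upper) (auto intro: bounded_imp_bdd_above compact_imp_bounded)
qed

lemma support_fun_attained:
  assumes "compact K" "K \<noteq> {}"
  obtains x where "x \<in> K" "support_fun K u = x \<bullet> u"
proof -
  obtain x where x: "x \<in> K" "\<And>y. y \<in> K \<Longrightarrow> y \<bullet> u \<le> x \<bullet> u"
  proof -
    have "continuous_on K (\<lambda>x. x \<bullet> u)" by (intro continuous_intros)
    from continuous_attains_sup[OF assms this] show thesis using that by blast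
  qed
  have "support_fun K u = x \<bullet> u"
    unfolding support_fun_def using x by (intro cSup_eq_maximum) auto
  with x(1) show thesis by (rule that)
qed

lemma support_fun_eqI:
  assumes "compact K" "x \<in> K" "x \<bullet> u = c" "\<And>y. y \<in> K \<Longrightarrow> y \<bullet> u \<le> c"
  shows "support_fun K u = c"
proof -
  obtain y where "y \<in> K" "support_fun K u = y \<bullet> u"
    using support_fun_attained[OF assms(1)] assms(2) by blast
  then show ?thesis using assms(3,4) inner_le_support_fun[OF assms(1,2), of u] by force
qed

lemma support_fun_plus:
  assumes "compact K" "K \<noteq> {}" "compact L" "L \<noteq> {}"
  shows "support_fun (K + L) u = support_fun K u + support_fun L u"
proof -
  obtain x y where xy: "x \<in> K" "support_fun K u = x \<bullet> u" "y \<in> L" "support_fun L u = y \<bullet> u"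
    using support_fun_attained assms by metis
  show ?thesis
  proof (rule support_fun_eqI)
    show "x + y \<in> K + L" using xy by (auto intro: set_plus_intro)
    fix z assume "z \<in> K + L"
    then obtain a b where "z = a + b" "a \<in> K" "b \<in> L" by (rule set_plus_elim)
    then show "z \<bullet> u \<le> support_fun K u + support_fun L u"
      using assms by (auto simp: inner_add_left intro!: add_mono inner_le_support_fun)
  qed (use assms xy compact_set_plus in \<open>auto simp: inner_add_left\<close>)
qed

lemma support_fun_scaleR:
  assumes "compact K" "K \<noteq> {}" "a \<ge> 0"
  shows "support_fun ((*\<^sub>R) a ` K) u = a * support_fun K u"
proof -
  obtain x where x: "x \<in> K" "support_fun K u = x \<bullet> u" using support_fun_attained assms by metis
  show ?thesis
    by (rule support_fun_eqI[of _ "a *\<^sub>R x"])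
      (use assms x inner_le_support_fun[OF assms(1), of _ u] in \<open>auto intro!: compact_scaling mult_left_mono\<close>)
qed

lemma support_fun_uminus:
  assumes "compact K" "K \<noteq> {}"
  shows "support_fun (uminus ` K) u = support_fun K (- u)"
proof -
  obtain x where x: "x \<in> K" "support_fun K (- u) = x \<bullet> - u" using support_fun_attained assms by metis
  show ?thesis
    by (rule support_fun_eqI[of _ "- x"])
      (use assms x inner_le_support_fun[OF assms(1), of _ "- u"] in \<open>auto intro!: compact_negations\<close>)
qed

lemma support_fun_cball:
  fixes u :: "'a::euclidean_space"
  shows "norm u = 1 \<Longrightarrow> support_fun (cball 0 1) u = 1"
proof (rule support_fun_eqI[of _ u])
  fix y :: 'a assume "norm u = 1" "y \<in> cball 0 1"
  then show "y \<bullet> u \<le> 1" using norm_cauchy_schwarz[of y u] by simp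
qed (auto simp: dot_square_norm)

lemma subset_if_support_fun_le:
  fixes K L :: "'a::euclidean_space set"
  assumes "compact K" "compact L" "convex L" "L \<noteq> {}"
    and le: "\<And>u. norm u = 1 \<Longrightarrow> support_fun K u \<le> support_fun L u"
  shows "K \<subseteq> L"
proof (rule subsetI, rule ccontr)
  fix x assume x: "x \<in> K" "x \<notin> L"
  obtain a b where ab: "a \<bullet> x < b" "\<And>y. y \<in> L \<Longrightarrow> b < a \<bullet> y"
    using separating_hyperplane_closed_point[OF assms(3) compact_imp_closed[OF assms(2)] x(2)] by blast
  have a: "a \<noteq> 0" using ab assms(4) by force
  \<comment> \<open>The separation puts \<open>L\<close> on the side of larger
    \<open>a \<bullet> y\<close>, so the unit normal pointing from \<open>L\<close> towards
    \<open>x\<close> is opposite to \<open>a\<close>.\<close>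
  define u where "u = - (1 / norm a) *\<^sub>R a"
  have u: "norm u = 1" using a by (simp add: u_def)
  have iu: "z \<bullet> u = - (a \<bullet> z) / norm a" for z by (simp add: u_def inner_commute)
  obtain y where y: "y \<in> L" "support_fun L u = y \<bullet> u"
    using support_fun_attained[OF assms(2,4)] by blast
  have "- (a \<bullet> x) / norm a \<le> - (a \<bullet> y) / norm a"
    using inner_le_support_fun[OF assms(1) x(1), of u] le[OF u] y(2) unfolding iu by linarith
  then show False using a ab(1) ab(2)[OF y(1)] by (simp add: divide_le_cancel)
qed

lemma eq_if_support_fun_eq:
  fixes K L :: "'a::euclidean_space set"
  assumes "compact K" "convex K" "K \<noteq> {}" "compact L" "convex L" "L \<noteq> {}"
    and "\<And>u. norm u = 1 \<Longrightarrow> support_fun K u = support_fun L u"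
  shows "K = L"
  using subset_if_support_fun_le[of K L] subset_if_support_fun_le[of L K] assms by simp

lemma convex_body_nonempty: "convex_body K \<Longrightarrow> K \<noteq> {}"
  by (auto simp: convex_body_def)

text \<open>A translate of the interior of \<open>A\<close> by a point of \<open>B\<close> lies in
  the sum. Interior points are demanded of one summand only, to cover \<open>reflection_path\<close>
  at \<open>t = 1\<close> and \<open>t = -1\<close>.\<close>

lemma convex_body_plus:
  assumes "convex_body A" "compact B" "convex B" "B \<noteq> {}"
  shows "convex_body (A + B)"
proof -
  obtain a where a: "a \<in> interior A" using assms(1) by (auto simp: convex_body_def)
  obtain b where b: "b \<in> B" using assms(4) by blast
  have "(+) b ` interior A \<subseteq> A + B"
  proof
    fix z assume "z \<in> (+) b ` interior A"
    then obtain y where "z = y + b" "y \<in> A" using interior_subset by (force simp: add.commute)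
    then show "z \<in> A + B" using b by (auto intro: set_plus_intro)
  qed
  then have "(+) b ` interior A \<subseteq> interior (A + B)"
    by (intro interior_maximal open_translation open_interior)
  then have "interior (A + B) \<noteq> {}" using a by blast
  then show ?thesis
    using assms by (auto simp: convex_body_def intro: compact_set_plus convex_set_plus)
qed

lemma convex_body_scaleR:
  assumes "convex_body A" "c > 0"
  shows "convex_body ((*\<^sub>R) c ` A)"
proof -
  have "(*\<^sub>R) c ` interior A \<subseteq> interior ((*\<^sub>R) c ` A)"
    using assms(2) by (intro interior_maximal open_scaling image_mono interior_subset) auto
  then show ?thesis
    using assms by (auto simp: convex_body_def intro: compact_scaling convex_scaling)
qed

lemma convex_body_uminus:
  assumes "convex_body A"
  shows "convex_body (uminus ` A)"
proof -
  have "uminus ` interior A \<subseteq> interior (uminus ` A)"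
    by (intro interior_maximal open_negations image_mono interior_subset) auto
  then show ?thesis
    using assms by (auto simp: convex_body_def intro: compact_negations convex_negations)
qed

lemma convex_body_cball: "convex_body (cball 0 1)"
  by (simp add: convex_body_def)

section \<open>Extension of functionals from bodies to differences of support functions\<close>

text \<open>Fixes one of many possible pairs; additive functionals do not see which one, by
  \<open>body_functional_respects_combination\<close>.\<close>

definition representing_bodies :: "('a::euclidean_space \<Rightarrow> real) \<Rightarrow> 'a set \<times> 'a set" where
  "representing_bodies f = (SOME p. convex_body (fst p) \<and> convex_body (snd p) \<and>
     (\<forall>u\<in>sphere 0 1. f u = support_fun (fst p) u - support_fun (snd p) u))"

lemma representing_bodies:
  assumes "f \<in> support_differences"
  shows "convex_body (fst (representing_bodies f))" "convex_body (snd (representing_bodies f))"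
    "norm u = 1 \<Longrightarrow> f u = support_fun (fst (representing_bodies f)) u - support_fun (snd (representing_bodies f)) u"
proof -
  have "\<exists>p. convex_body (fst p) \<and> convex_body (snd p) \<and>
     (\<forall>u\<in>sphere 0 1. f u = support_fun (fst p) u - support_fun (snd p) u)"
    using assms unfolding support_differences_def by auto
  from someI_ex[OF this, folded representing_bodies_def]
  show "convex_body (fst (representing_bodies f))" "convex_body (snd (representing_bodies f))"
    "norm u = 1 \<Longrightarrow> f u = support_fun (fst (representing_bodies f)) u - support_fun (snd (representing_bodies f)) u"
    by auto
qed

text \<open>The signed sum of \<open>G\<close> over all ways to put the first or the second
  representing body into each slot, the sign counting second bodies. The recursion feeds the slots
  into \<open>G\<close> one at a time, so \<open>G\<close> changes along the list.\<close>

primrec extend_to_differences :: "('a::euclidean_space set list \<Rightarrow> real) \<Rightarrow> ('a \<Rightarrow> real) list \<Rightarrow> real" where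
  "extend_to_differences G [] = G []"
| "extend_to_differences G (f # fs) =
    extend_to_differences (\<lambda>Ks. G (fst (representing_bodies f) # Ks)) fs -
    extend_to_differences (\<lambda>Ks. G (snd (representing_bodies f) # Ks)) fs"

text \<open>Linearity in the functional, not in the functions of the list; it carries a relation
  established in the head slot through the remaining ones.\<close>

lemma extend_to_differences_linear:
  "extend_to_differences (\<lambda>Ks. a * G Ks + b * H Ks) fs =
    a * extend_to_differences G fs + b * extend_to_differences H fs"
  by (induction fs arbitrary: G H) (simp_all add: algebra_simps)

lemma extend_to_differences_diff:
  "extend_to_differences (\<lambda>Ks. G Ks - H Ks) fs = extend_to_differences G fs - extend_to_differences H fs"
  using extend_to_differences_linear[of 1 G "-1" H fs] by simp

lemma extend_to_differences_cong:
  assumes "set fs \<subseteq> support_differences"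
    and "\<And>Ks. length Ks = length fs \<Longrightarrow> \<forall>K\<in>set Ks. convex_body K \<Longrightarrow> G Ks = H Ks"
  shows "extend_to_differences G fs = extend_to_differences H fs"
  using assms
proof (induction fs arbitrary: G H)
  case (Cons f fs)
  have "extend_to_differences (\<lambda>Ks. G (K # Ks)) fs = extend_to_differences (\<lambda>Ks. H (K # Ks)) fs"
    if "convex_body K" for K
    using Cons.prems that by (intro Cons.IH) auto
  from this[OF representing_bodies(1)[of f]] this[OF representing_bodies(2)[of f]] show ?case
    using Cons.prems by simp
qed simp

lemma convex_bodyD:
  assumes "convex_body K"
  shows "compact K" "convex K" "K \<noteq> {}"
  using assms convex_body_nonempty by (auto simp: convex_body_def)

text \<open>
  Moving the terms with negative coefficients to the other side turns a linear relation between
  differences of support functions into an equality of two Minkowski sums.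
\<close>

lemma body_functional_respects_combination:
  fixes G :: "(real^'n) set \<Rightarrow> real"
  assumes G: "\<And>X Y a b. exhaustible X \<Longrightarrow> exhaustible Y \<Longrightarrow> a \<ge> 0 \<Longrightarrow> b \<ge> 0 \<Longrightarrow>
      G ((*\<^sub>R) a ` X + (*\<^sub>R) b ` Y) = a * G X + b * G Y"
    and K: "convex_body K" "convex_body L" "convex_body K1" "convex_body L1" "convex_body K2" "convex_body L2"
    and eq: "\<And>u. norm u = 1 \<Longrightarrow> support_fun K u - support_fun L u =
      a * (support_fun K1 u - support_fun L1 u) + b * (support_fun K2 u - support_fun L2 u)"
  shows "G K - G L = a * (G K1 - G L1) + b * (G K2 - G L2)"
proof -
  \<comment> \<open>The positive part splits a coefficient \<open>c\<close> as
    \<open>p c - p (- c)\<close> into two nonnegative ones, as dilates require.\<close>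
  define p where "p = (\<lambda>c::real. max c 0)"
  have p: "p c \<ge> 0" for c by (simp add: p_def)
  have p_diff: "c = p c - p (- c)" for c by (simp add: p_def)
  let ?C = "\<lambda>a b X Y. (*\<^sub>R) a ` X + (*\<^sub>R) b ` Y"
  \<comment> \<open>Admits \<open>{0}\<close>, which arises as a combination when both coefficients
    are zero.\<close>
  define ok where "ok X \<longleftrightarrow> exhaustible X \<and> compact X \<and> convex X \<and> X \<noteq> {}" for X :: "(real^'n) set"
  have okC: "ok (?C a b X Y)" if "ok X" "ok Y" "a \<ge> 0" "b \<ge> 0" for a b X Y
    using that unfolding ok_def
    by (auto intro!: compact_set_plus convex_set_plus compact_scaling convex_scaling exhaustible_add exhaustible_scaleR)
  have supp: "support_fun (?C a b X Y) u = a * support_fun X u + b * support_fun Y u"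
    if "ok X" "ok Y" "a \<ge> 0" "b \<ge> 0" for a b u X Y
    using that unfolding ok_def by (simp add: support_fun_plus support_fun_scaleR compact_scaling)
  have GC: "G (?C a b X Y) = a * G X + b * G Y" if "ok X" "ok Y" "a \<ge> 0" "b \<ge> 0" for a b X Y
    using G that unfolding ok_def by blast
  have ok: "ok K" "ok L" "ok K1" "ok L1" "ok K2" "ok L2"
    using K exhaustible_convex_body convex_bodyD unfolding ok_def by blast+
  \<comment> \<open>\<open>A1\<close> and \<open>A2\<close> collect what is moved to the side of
    \<open>K\<close>, \<open>B1\<close> and \<open>B2\<close> what stays beside \<open>L\<close>, so
    that \<open>K + A1 + A2 = L + B1 + B2\<close>.\<close>
  define A1 A2 B1 B2 where "A1 = ?C (p (- a)) (p a) K1 L1" and "A2 = ?C (p (- b)) (p b) K2 L2"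
    and "B1 = ?C (p a) (p (- a)) K1 L1" and "B2 = ?C (p b) (p (- b)) K2 L2"
  have okAB: "ok A1" "ok A2" "ok B1" "ok B2"
    unfolding A1_def A2_def B1_def B2_def by (intro okC ok p)+
  have okAB': "ok (?C 1 1 A1 A2)" "ok (?C 1 1 B1 B2)" by (intro okC okAB; simp)+
  have sum_eq: "?C 1 1 K (?C 1 1 A1 A2) = ?C 1 1 L (?C 1 1 B1 B2)" (is "?P = ?Q")
  proof -
    have "ok ?P" "ok ?Q" by (intro okC ok okAB'; simp)+
    moreover have "support_fun ?P u = support_fun ?Q u" if "norm u = 1" for u
    proof -
      have "support_fun K u - support_fun L u =
          (p a - p (- a)) * (support_fun K1 u - support_fun L1 u) + (p b - p (- b)) * (support_fun K2 u - support_fun L2 u)"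
        using eq[OF that] p_diff by simp
      then show ?thesis
        using supp[OF ok(1) okAB'(1), of 1 1 u] supp[OF ok(2) okAB'(2), of 1 1 u]
          supp[OF okAB(1,2), of 1 1 u] supp[OF okAB(3,4), of 1 1 u]
          supp[OF ok(3,4) p p, of "- a" a u] supp[OF ok(3,4) p p, of a "- a" u]
          supp[OF ok(5,6) p p, of "- b" b u] supp[OF ok(5,6) p p, of b "- b" u]
        unfolding A1_def[symmetric] A2_def[symmetric] B1_def[symmetric] B2_def[symmetric]
        by (simp add: algebra_simps)
    qed
    ultimately show ?thesis unfolding ok_def by (intro eq_if_support_fun_eq) auto
  qed
  have "G K - G L = (p a - p (- a)) * (G K1 - G L1) + (p b - p (- b)) * (G K2 - G L2)"
    using GC[OF ok(1) okAB'(1), of 1 1] GC[OF ok(2) okAB'(2), of 1 1]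
      GC[OF okAB(1,2), of 1 1] GC[OF okAB(3,4), of 1 1]
      GC[OF ok(3,4) p p, of "- a" a] GC[OF ok(3,4) p p, of a "- a"]
      GC[OF ok(5,6) p p, of "- b" b] GC[OF ok(5,6) p p, of b "- b"]
    unfolding A1_def[symmetric] A2_def[symmetric] B1_def[symmetric] B2_def[symmetric] sum_eq
    by (simp add: algebra_simps)
  then show ?thesis using p_diff by metis
qed


definition additive_in_slots :: "nat \<Rightarrow> ((real^'n) set list \<Rightarrow> real) \<Rightarrow> bool" where
  "additive_in_slots m G \<longleftrightarrow> (\<forall>Ks i X Y a b. length Ks = m \<longrightarrow> (\<forall>K\<in>set Ks. exhaustible K) \<longrightarrow> i < m \<longrightarrow>
     exhaustible X \<longrightarrow> exhaustible Y \<longrightarrow> a \<ge> 0 \<longrightarrow> b \<ge> 0 \<longrightarrow>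
     G (Ks[i := (*\<^sub>R) a ` X + (*\<^sub>R) b ` Y]) = a * G (Ks[i := X]) + b * G (Ks[i := Y]))"

lemma additive_in_slotsD:
  assumes "additive_in_slots m G" "length Ks = m" "\<forall>K\<in>set Ks. exhaustible K" "i < m"
    "exhaustible X" "exhaustible Y" "a \<ge> 0" "b \<ge> 0"
  shows "G (Ks[i := (*\<^sub>R) a ` X + (*\<^sub>R) b ` Y]) = a * G (Ks[i := X]) + b * G (Ks[i := Y])"
  using assms unfolding additive_in_slots_def by blast

lemma additive_in_slots_Cons:
  fixes K :: "(real^'n) set"
  assumes "additive_in_slots (Suc m) G" "exhaustible K"
  shows "additive_in_slots m (\<lambda>Ks. G (K # Ks))"
  unfolding additive_in_slots_def
proof (intro allI impI)
  fix Ks :: "(real^'n) set list" and i and X Y :: "(real^'n) set" and a b :: real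
  assume *: "length Ks = m" "\<forall>K\<in>set Ks. exhaustible K" "i < m" "exhaustible X" "exhaustible Y" "0 \<le> a" "0 \<le> b"
  show "G (K # Ks[i := (*\<^sub>R) a ` X + (*\<^sub>R) b ` Y]) = a * G (K # Ks[i := X]) + b * G (K # Ks[i := Y])"
    using additive_in_slotsD[OF assms(1), of "K # Ks" "Suc i" X Y a b] * assms(2) by simp
qed

lemma additive_in_slots_head:
  assumes "additive_in_slots (Suc m) G" "length Ks = m" "\<forall>K\<in>set Ks. exhaustible K"
    "exhaustible X" "exhaustible Y" "a \<ge> 0" "b \<ge> 0"
  shows "G (((*\<^sub>R) a ` X + (*\<^sub>R) b ` Y) # Ks) = a * G (X # Ks) + b * G (Y # Ks)"
  using additive_in_slotsD[OF assms(1), of "X # Ks" 0 X Y a b] assms by simp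

text \<open>In the head slot the pair chosen for the combination is unrelated to those for
  \<open>f\<close> and \<open>g\<close>, but with bodies in the other slots the functional respects
  the relation between their support functions. Later slots follow by induction for the two
  functionals that arise from filling the head.\<close>

lemma extend_to_differences_multilinear:
  fixes f g :: "real^'n \<Rightarrow> real"
  assumes "additive_in_slots (length fs) G" "set fs \<subseteq> support_differences" "i < length fs"
    and fg: "f \<in> support_differences" "g \<in> support_differences" "(\<lambda>u. a * f u + b * g u) \<in> support_differences"
  shows "extend_to_differences G (fs[i := (\<lambda>u. a * f u + b * g u)]) =
    a * extend_to_differences G (fs[i := f]) + b * extend_to_differences G (fs[i := g])"
  using assms(1-3)
proof (induction fs arbitrary: G i)
  case (Cons e fs)
  note ex = representing_bodies(1,2)[THEN exhaustible_convex_body]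
  show ?case
  proof (cases i)
    case 0
    let ?h = "\<lambda>u. a * f u + b * g u"
    let ?D = "\<lambda>f Ks. G (fst (representing_bodies f) # Ks) - G (snd (representing_bodies f) # Ks)"
    have "?D ?h Ks = a * ?D f Ks + b * ?D g Ks"
      if Ks: "length Ks = length fs" "\<forall>K\<in>set Ks. convex_body K" for Ks
    proof (rule body_functional_respects_combination)
      show "G (((*\<^sub>R) c ` X + (*\<^sub>R) d ` Y) # Ks) = c * G (X # Ks) + d * G (Y # Ks)"
        if "exhaustible X" "exhaustible Y" "c \<ge> 0" "d \<ge> 0" for X Y :: "(real^'n) set" and c d :: real
        using additive_in_slots_head[of "length fs" G Ks X Y c d] Cons.prems(1) Ks that exhaustible_convex_body by auto
      fix u :: "real^'n" assume u: "norm u = 1"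
      show "support_fun (fst (representing_bodies ?h)) u - support_fun (snd (representing_bodies ?h)) u =
        a * (support_fun (fst (representing_bodies f)) u - support_fun (snd (representing_bodies f)) u) +
        b * (support_fun (fst (representing_bodies g)) u - support_fun (snd (representing_bodies g)) u)"
        using representing_bodies(3)[OF fg(1) u] representing_bodies(3)[OF fg(2) u] representing_bodies(3)[OF fg(3) u]
        by simp
    qed (use fg representing_bodies in auto)
    then have "extend_to_differences (?D ?h) fs = extend_to_differences (\<lambda>Ks. a * ?D f Ks + b * ?D g Ks) fs"
      using Cons.prems(2) by (intro extend_to_differences_cong) auto
    then show ?thesis
      using 0 by (simp add: extend_to_differences_linear extend_to_differences_diff)
  next
    case (Suc j)
    have "additive_in_slots (length fs) (\<lambda>Ks. G (fst (representing_bodies e) # Ks))"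
      "additive_in_slots (length fs) (\<lambda>Ks. G (snd (representing_bodies e) # Ks))"
      using Cons.prems ex by (auto intro!: additive_in_slots_Cons)
    then show ?thesis using Suc Cons.prems Cons.IH[of _ j] by (simp add: algebra_simps)
  qed
qed simp

text \<open>The point \<open>{0}\<close> is no convex body, so the unit ball is added to
  \<open>K\<close> and subtracted again.\<close>

lemma is_support_fun_imp_difference:
  assumes "is_support_fun f K"
  shows "f \<in> support_differences"
proof -
  have K: "convex_body K" "\<And>u. norm u = 1 \<Longrightarrow> f u = support_fun K u"
    using assms by (auto simp: is_support_fun_def)
  note B = convex_bodyD[OF convex_body_cball]
  have "f u = support_fun (K + cball 0 1) u - support_fun (cball 0 1) u" if "norm u = 1" for u
    using K(2)[OF that] support_fun_plus[OF convex_bodyD(1,3)[OF K(1)] B(1,3)] by simp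
  then show ?thesis
    unfolding support_differences_def using convex_body_plus[OF K(1) B] convex_body_cball by force
qed

text \<open>The pair chosen for the support function of \<open>K\<close> satisfies
  \<open>?P = K + ?Q\<close>, and additivity leaves \<open>G (K # Ks)\<close> in the
  difference.\<close>

lemma extend_to_differences_support_fun:
  fixes fs :: "(real^'n \<Rightarrow> real) list"
  assumes "list_all2 is_support_fun fs Ks" "additive_in_slots (length fs) G"
  shows "extend_to_differences G fs = G Ks"
  using assms
proof (induction fs Ks arbitrary: G rule: list_all2_induct)
  case (Cons f fs K Ks)
  let ?P = "fst (representing_bodies f)" and ?Q = "snd (representing_bodies f)"
  have f: "f \<in> support_differences" using Cons.hyps(1) by (rule is_support_fun_imp_difference)
  note PQ = representing_bodies(1,2)[OF f]
  have K: "convex_body K" "\<And>u. norm u = 1 \<Longrightarrow> f u = support_fun K u"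
    using Cons.hyps(1) by (auto simp: is_support_fun_def)
  note exh = PQ[THEN exhaustible_convex_body] K(1)[THEN exhaustible_convex_body]
  have Ks: "\<forall>K\<in>set Ks. exhaustible K" "length Ks = length fs"
    using Cons.hyps(2)
    by (auto simp: list_all2_conv_all_nth in_set_conv_nth is_support_fun_def intro!: exhaustible_convex_body)
  have KQ: "convex_body (K + ?Q)" using K(1) convex_bodyD[OF PQ(2)] by (intro convex_body_plus)
  have "?P = K + ?Q"
  proof (rule eq_if_support_fun_eq)
    fix u :: "real^'n" assume u: "norm u = 1"
    show "support_fun ?P u = support_fun (K + ?Q) u"
      using representing_bodies(3)[OF f u] K(2)[OF u]
        support_fun_plus[OF convex_bodyD(1,3)[OF K(1)] convex_bodyD(1,3)[OF PQ(2)], of u] by simp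
  qed (use PQ KQ convex_bodyD in auto)
  then have "G (?P # Ks) = G (K # Ks) + G (?Q # Ks)"
    using additive_in_slots_head[of "length fs" G Ks K ?Q 1 1] Cons.prems Ks exh by simp
  moreover have "extend_to_differences (\<lambda>Ks. G (Z # Ks)) fs = G (Z # Ks)" if "exhaustible Z" for Z
    using Cons.IH additive_in_slots_Cons Cons.prems that by auto
  ultimately show ?case using exh by simp
qed simp

lemma additive_in_slots_volume_polarization:
  "additive_in_slots CARD('n) (volume_polarization :: (real^'n) set list \<Rightarrow> real)"
  unfolding additive_in_slots_def
proof (intro allI impI)
  fix Ks :: "(real^'n) set list" and i and X Y :: "(real^'n) set" and a b :: real
  assume *: "length Ks = CARD('n)" "\<forall>K\<in>set Ks. exhaustible K" "i < CARD('n)"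
    "exhaustible X" "exhaustible Y" "0 \<le> a" "0 \<le> b"
  let ?R = "take i Ks @ drop (Suc i) Ks"
  have eq: "volume_polarization (Ks[i := Z]) = volume_polarization (Z # ?R)" for Z
    using * by (intro volume_polarization_mset) (simp add: upd_conv_take_nth_drop)
  show "volume_polarization (Ks[i := (*\<^sub>R) a ` X + (*\<^sub>R) b ` Y]) =
      a * volume_polarization (Ks[i := X]) + b * volume_polarization (Ks[i := Y])"
    unfolding eq using * by (intro volume_polarization_linear) (auto dest: in_set_takeD in_set_dropD)
qed

lemma support_differences_add:
  assumes "f \<in> support_differences" "g \<in> support_differences"
  shows "(\<lambda>u. f u + g u) \<in> support_differences"
proof -
  obtain K L where KL: "convex_body K" "convex_body L" "\<forall>u\<in>sphere 0 1. f u = support_fun K u - support_fun L u"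
    using assms(1) unfolding support_differences_def by blast
  obtain K' L' where KL': "convex_body K'" "convex_body L'" "\<forall>u\<in>sphere 0 1. g u = support_fun K' u - support_fun L' u"
    using assms(2) unfolding support_differences_def by blast
  note d = convex_bodyD[OF KL(1)] convex_bodyD[OF KL(2)] convex_bodyD[OF KL'(1)] convex_bodyD[OF KL'(2)]
  have "\<forall>u\<in>sphere 0 1. f u + g u = support_fun (K + K') u - support_fun (L + L') u"
    using KL(3) KL'(3) d by (simp add: support_fun_plus)
  then show ?thesis
    unfolding support_differences_def using convex_body_plus[OF KL(1) d(7-9)] convex_body_plus[OF KL(2) d(10-12)] by blast
qed

lemma support_differences_minus:
  assumes "f \<in> support_differences"
  shows "(\<lambda>u. - f u) \<in> support_differences"
proof -
  obtain K L where "convex_body K" "convex_body L" "\<forall>u\<in>sphere 0 1. f u = support_fun K u - support_fun L u"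
    using assms unfolding support_differences_def by blast
  moreover from this have "\<forall>u\<in>sphere 0 1. - f u = support_fun L u - support_fun K u" by simp
  ultimately show ?thesis unfolding support_differences_def by blast
qed

lemma support_differences_mult_nonneg:
  assumes "f \<in> support_differences" "a > 0"
  shows "(\<lambda>u. a * f u) \<in> support_differences"
proof -
  obtain K L where KL: "convex_body K" "convex_body L" "\<forall>u\<in>sphere 0 1. f u = support_fun K u - support_fun L u"
    using assms(1) unfolding support_differences_def by blast
  have "\<forall>u\<in>sphere 0 1. a * f u = support_fun ((*\<^sub>R) a ` K) u - support_fun ((*\<^sub>R) a ` L) u"
    using KL convex_bodyD[OF KL(1)] convex_bodyD[OF KL(2)] assms(2) by (simp add: support_fun_scaleR right_diff_distrib)
  then show ?thesis
    unfolding support_differences_def using convex_body_scaleR KL assms(2) by blast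
qed

lemma support_differences_mult:
  fixes f :: "'a::euclidean_space \<Rightarrow> real"
  assumes "f \<in> support_differences"
  shows "(\<lambda>u. a * f u) \<in> support_differences"
proof -
  consider "a > 0" | "a = 0" | "a < 0" by linarith
  then show ?thesis
  proof cases
    case 2
    then show ?thesis using convex_body_cball unfolding support_differences_def by force
  next
    case 3
    then show ?thesis
      using support_differences_minus[OF support_differences_mult_nonneg[OF assms, of "- a"]] by simp
  qed (rule support_differences_mult_nonneg[OF assms])
qed

lemma support_differences_combination:
  "f \<in> support_differences \<Longrightarrow> g \<in> support_differences \<Longrightarrow> (\<lambda>u. a * f u + b * g u) \<in> support_differences"
  by (intro support_differences_add support_differences_mult)

lemma list_all2_is_support_funD:
  assumes "list_all2 is_support_fun fs Ks"
  shows "\<forall>K\<in>set Ks. convex_body K" "length Ks = length fs"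
  using assms by (auto simp: list_all2_conv_all_nth in_set_conv_nth is_support_fun_def)

section \<open>Existence and uniqueness of the extension, and the symmetries it inherits\<close>

lemma multilinear_extension_exists:
  "multilinear_extension (extend_to_differences volume_polarization :: ((real^'n \<Rightarrow> real) list \<Rightarrow> real))"
  unfolding multilinear_extension_def
proof (intro conjI allI impI)
  fix fs :: "(real^'n \<Rightarrow> real) list" and Ks
  assume len: "length fs = DIM(real^'n)" and supp: "list_all2 is_support_fun fs Ks"
  have "mixed_volume Ks = volume_polarization Ks"
    using list_all2_is_support_funD[OF supp] len by (intro mixed_volume_eq_polarization) (auto intro: exhaustible_convex_body)
  then show "extend_to_differences volume_polarization fs = mixed_volume Ks"
    using extend_to_differences_support_fun[OF supp, of volume_polarization] len
      additive_in_slots_volume_polarization[where 'n='n] by simp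
next
  fix fs :: "(real^'n \<Rightarrow> real) list" and i and f g :: "real^'n \<Rightarrow> real" and a b :: real
  assume "length fs = DIM(real^'n)" "set fs \<subseteq> support_differences" "i < DIM(real^'n)"
    "f \<in> support_differences" "g \<in> support_differences"
  then show "extend_to_differences volume_polarization (fs[i := (\<lambda>u. a * f u + b * g u)]) =
      a * extend_to_differences volume_polarization (fs[i := f]) +
      b * extend_to_differences volume_polarization (fs[i := g])"
    using additive_in_slots_volume_polarization[where 'n='n]
    by (intro extend_to_differences_multilinear) (auto intro: support_differences_combination)
qed

lemma multilinear_extensionD:
  fixes W :: "('a::euclidean_space \<Rightarrow> real) list \<Rightarrow> real"
  assumes "multilinear_extension W" "length fs = DIM('a)"
  shows "list_all2 is_support_fun fs Ks \<Longrightarrow> W fs = mixed_volume (Ks :: 'a set list)"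
    and "set fs \<subseteq> support_differences \<Longrightarrow> i < DIM('a) \<Longrightarrow>
      f \<in> support_differences \<Longrightarrow> g \<in> support_differences \<Longrightarrow>
        W (fs[i := (\<lambda>u. a * f u + b * g u)]) = a * W (fs[i := f]) + b * W (fs[i := g])"
  using assms unfolding multilinear_extension_def by blast+

text \<open>Induction on the number \<open>j\<close> of leading slots that may hold genuine
  differences, all later slots holding support functions. Splitting one slot into two support
  functions lowers \<open>j\<close>; at \<open>j = 0\<close> both functionals equal the mixed volume
  of bodies.\<close>

lemma multilinear_extension_unique:
  fixes W W' :: "('a::euclidean_space \<Rightarrow> real) list \<Rightarrow> real"
  assumes W: "multilinear_extension W" and W': "multilinear_extension W'"
    and fs: "length fs = DIM('a)" "set fs \<subseteq> support_differences"
  shows "W fs = W' fs"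
proof -
  have *: "W fs = W' fs"
    if "length fs = DIM('a)" "set fs \<subseteq> support_differences"
      "\<forall>i. j \<le> i \<and> i < DIM('a) \<longrightarrow> (\<exists>K. is_support_fun (fs ! i) K)" "j \<le> DIM('a)" for j fs
    using that
  proof (induction j arbitrary: fs)
    case 0
    then obtain Kf where "\<And>i. i < DIM('a) \<Longrightarrow> is_support_fun (fs ! i) (Kf i)" by (metis zero_le)
    then have "list_all2 is_support_fun fs (map Kf [0..<DIM('a)])"
      using 0 by (simp add: list_all2_conv_all_nth)
    then show ?case using multilinear_extensionD(1)[OF W] multilinear_extensionD(1)[OF W'] 0 by metis
  next
    case (Suc j)
    let ?f = "fs ! j"
    have "?f \<in> support_differences" using Suc.prems by (auto simp: subset_iff)
    then obtain K L where KL: "convex_body K" "convex_body L" "\<forall>u\<in>sphere 0 1. ?f u = support_fun K u - support_fun L u"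
      unfolding support_differences_def by blast
    \<comment> \<open>Agrees with \<open>support_fun K\<close> on the sphere, and is defined through
      \<open>?f\<close> so that the decomposition of \<open>fs\<close> below is an equality of
      functions on the whole space.\<close>
    define g where "g = (\<lambda>u. ?f u + support_fun L u)"
    have s: "is_support_fun g K" "is_support_fun (support_fun L) L"
      using KL by (auto simp: is_support_fun_def g_def)
    note d = s[THEN is_support_fun_imp_difference]
    have f: "fs = fs[j := (\<lambda>u. 1 * g u + (-1) * support_fun L u)]" by (simp add: g_def)
    have "W (fs[j := h]) = W' (fs[j := h])" if "is_support_fun h M" for h M
    proof (rule Suc.IH)
      show "set (fs[j := h]) \<subseteq> support_differences"
        using Suc.prems(2) is_support_fun_imp_difference[OF that] set_update_subset_insert[of fs j h] by auto
      show "\<forall>i. j \<le> i \<and> i < DIM('a) \<longrightarrow> (\<exists>K. is_support_fun (fs[j := h] ! i) K)"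
      proof (intro allI impI)
        fix i assume "j \<le> i \<and> i < DIM('a)"
        then show "\<exists>K. is_support_fun (fs[j := h] ! i) K"
          using Suc.prems(1,3) that by (cases "i = j") auto
      qed
    qed (use Suc.prems in auto)
    from this[OF s(1)] this[OF s(2)] show ?case
      using multilinear_extensionD(2)[OF W Suc.prems(1,2) _ d, of j 1 "-1"]
        multilinear_extensionD(2)[OF W' Suc.prems(1,2) _ d, of j 1 "-1"] Suc.prems(4) f by simp
  qed
  show ?thesis by (rule *[where j="DIM('a)"]) (use fs in auto)
qed

lemma mixed_volume_fun_extension:
  "multilinear_extension (mixed_volume_fun :: (real^'n \<Rightarrow> real) list \<Rightarrow> real)"
  unfolding mixed_volume_fun_def by (rule someI[of multilinear_extension, OF multilinear_extension_exists])

lemma mixed_volume_mset: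
  fixes Ks Ls :: "(real^'n) set list"
  assumes "mset Ks = mset Ls" "length Ks = CARD('n)" "\<forall>K\<in>set Ks. convex_body K"
  shows "mixed_volume Ks = mixed_volume Ls"
proof -
  have "length Ls = length Ks" "set Ls = set Ks" using assms(1) by (metis size_mset, metis set_mset_mset)
  moreover have "\<forall>K\<in>set Ks. exhaustible K" using assms(3) by (auto intro!: exhaustible_convex_body)
  ultimately show ?thesis
    using assms(2) volume_polarization_mset[OF assms(1)] by (simp add: mixed_volume_eq_polarization)
qed

text \<open>Permuting the arguments before applying \<open>mixed_volume_fun\<close> gives another
  multilinear extension, because mixed volumes of bodies are symmetric; uniqueness identifies the
  two.\<close>

lemma mixed_volume_fun_mset:
  fixes fs gs :: "(real^'n \<Rightarrow> real) list"
  assumes "mset fs = mset gs" "length fs = CARD('n)" "set fs \<subseteq> support_differences"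
  shows "mixed_volume_fun fs = mixed_volume_fun gs"
proof -
  obtain p where p: "p permutes {..<length gs}" "permute_list p gs = fs"
    using mset_eq_permutation[OF assms(1)] .
  have len: "length gs = CARD('n)" using assms(1,2) by (metis size_mset)
  note pn = p(1)[unfolded len]
  have "multilinear_extension (\<lambda>fs :: (real^'n \<Rightarrow> real) list. mixed_volume_fun (permute_list p fs))"
    unfolding multilinear_extension_def
  proof (intro conjI allI impI)
    fix hs :: "(real^'n \<Rightarrow> real) list" and Ks
    assume l: "length hs = DIM(real^'n)" and s: "list_all2 is_support_fun hs Ks"
    have ph: "p permutes {..<length hs}" "p permutes {..<length Ks}"
      using pn l list_all2_is_support_funD(2)[OF s] by simp_all
    have "mixed_volume_fun (permute_list p hs) = mixed_volume (permute_list p Ks)"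
      using l s ph by (intro multilinear_extensionD(1)[OF mixed_volume_fun_extension]) (simp_all add: list_all2_permute_list_iff)
    also have "\<dots> = mixed_volume Ks"
      using l list_all2_is_support_funD[OF s] ph by (intro mixed_volume_mset) auto
    finally show "mixed_volume_fun (permute_list p hs) = mixed_volume Ks" .
  next
    fix hs :: "(real^'n \<Rightarrow> real) list" and i and f g :: "real^'n \<Rightarrow> real" and a b :: real
    assume l: "length hs = DIM(real^'n)" "set hs \<subseteq> support_differences" "i < DIM(real^'n)"
      "f \<in> support_differences" "g \<in> support_differences"
    \<comment> \<open>\<open>permute_list p\<close> puts the entry with index \<open>p k\<close> at
      position \<open>k\<close>, so slot \<open>i\<close> moves to \<open>inv p i\<close>.\<close>
    have upd: "permute_list p (hs[i := h]) = (permute_list p hs)[inv p i := h]" for h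
    proof (rule nth_equalityI)
      fix k assume "k < length (permute_list p (hs[i := h]))"
      then have k: "k < CARD('n)" using l by simp
      have pk: "p k < CARD('n)" using permutes_in_image[OF pn, of k] k by simp
      have ik: "inv p i = k \<longleftrightarrow> i = p k"
        using pn by (metis permutes_inverses(1) permutes_inverses(2))
      show "permute_list p (hs[i := h]) ! k = (permute_list p hs)[inv p i := h] ! k"
        using pn l k pk by (simp add: permute_list_nth nth_list_update ik permutes_inverses(2)[OF pn])
    qed simp
    have "inv p i < DIM(real^'n)" using permutes_in_image[OF permutes_inv[OF pn], of i] l by simp
    moreover have "set (permute_list p hs) \<subseteq> support_differences" using pn l by simp
    ultimately show "mixed_volume_fun (permute_list p (hs[i := (\<lambda>u. a * f u + b * g u)])) =
      a * mixed_volume_fun (permute_list p (hs[i := f])) + b * mixed_volume_fun (permute_list p (hs[i := g]))"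
      unfolding upd using l by (intro multilinear_extensionD(2)[OF mixed_volume_fun_extension]) auto
  qed
  from multilinear_extension_unique[OF this mixed_volume_fun_extension, of gs]
  show ?thesis using p len assms set_permute_list[OF p(1)] by simp
qed

lemma sum_uminus_image:
  fixes K :: "'i \<Rightarrow> 'a::real_vector set"
  shows "(\<Sum>i\<in>I. uminus ` K i) = uminus ` (\<Sum>i\<in>I. K i)"
proof (induction I rule: infinite_finite_induct)
  case (insert i I)
  have "uminus ` A + uminus ` B = uminus ` (A + B)" for A B :: "'a set"
  proof -
    have "uminus ` A + uminus ` B = {- a - b | a b. a \<in> A \<and> b \<in> B}" unfolding set_plus_def by auto
    also have "\<dots> = uminus ` (A + B)" unfolding set_plus_def by (force simp: image_iff)
    finally show ?thesis .
  qed
  with insert show ?case by simp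
qed (auto simp: set_zero)

text \<open>Reflection commutes with Minkowski sums and preserves Lebesgue measure, so every term of
  the polarization is unchanged.\<close>

lemma mixed_volume_uminus:
  fixes Ks :: "(real^'n) set list"
  assumes "length Ks = CARD('n)" "\<forall>K\<in>set Ks. convex_body K"
  shows "mixed_volume (map ((`) uminus) Ks) = mixed_volume Ks"
proof -
  have refl: "measure lebesgue (uminus ` A) = measure lebesgue A" for A :: "(real^'n) set"
    using measure_lebesgue_affine[of "-1" "0 :: real^'n" A] by simp
  have ex: "\<forall>K\<in>set Ks. exhaustible K" "\<forall>K\<in>set Ks. exhaustible (uminus ` K)"
    using assms(2) by (auto intro!: exhaustible_convex_body convex_body_uminus)
  have "volume_polarization (map ((`) uminus) Ks) = polarization (length Ks) (measure lebesgue) (\<lambda>i. uminus ` (Ks ! i))"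
    unfolding volume_polarization_def by (simp, rule polarization_cong) simp
  also have "\<dots> = volume_polarization Ks"
    unfolding volume_polarization_def polarization_def by (simp add: sum_uminus_image refl)
  finally show ?thesis
    using assms(1) ex by (simp add: mixed_volume_eq_polarization)
qed

lemma is_support_fun_reflect:
  "is_support_fun f K \<Longrightarrow> is_support_fun (\<lambda>u. f (- u)) (uminus ` K)"
  by (auto simp: is_support_fun_def convex_body_uminus support_fun_uminus convex_bodyD)

lemma support_differences_reflect:
  assumes "f \<in> support_differences"
  shows "(\<lambda>u. f (- u)) \<in> support_differences"
proof -
  obtain K L where KL: "convex_body K" "convex_body L" "\<forall>u\<in>sphere 0 1. f u = support_fun K u - support_fun L u"
    using assms unfolding support_differences_def by blast
  have "\<forall>u\<in>sphere 0 1. f (- u) = support_fun (uminus ` K) u - support_fun (uminus ` L) u"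
    using KL by (simp add: support_fun_uminus convex_bodyD)
  then show ?thesis
    unfolding support_differences_def using convex_body_uminus KL by blast
qed

text \<open>Uniqueness again: reflecting all arguments first gives a multilinear extension, whose
  values on bodies are right by \<open>mixed_volume_uminus\<close>.\<close>

lemma mixed_volume_fun_reflect:
  fixes fs :: "(real^'n \<Rightarrow> real) list"
  assumes "length fs = CARD('n)" "set fs \<subseteq> support_differences"
  shows "mixed_volume_fun (map (\<lambda>f u. f (- u)) fs) = mixed_volume_fun fs"
proof -
  have "multilinear_extension (\<lambda>fs :: (real^'n \<Rightarrow> real) list. mixed_volume_fun (map (\<lambda>f u. f (- u)) fs))"
    unfolding multilinear_extension_def
  proof (intro conjI allI impI)
    fix hs :: "(real^'n \<Rightarrow> real) list" and Ks
    assume l: "length hs = DIM(real^'n)" and s: "list_all2 is_support_fun hs Ks"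
    have "mixed_volume_fun (map (\<lambda>f u. f (- u)) hs) = mixed_volume (map ((`) uminus) Ks)"
      using l s
      by (intro multilinear_extensionD(1)[OF mixed_volume_fun_extension])
        (auto simp: list_all2_conv_all_nth intro!: is_support_fun_reflect)
    also have "\<dots> = mixed_volume Ks"
      using l list_all2_is_support_funD[OF s] by (intro mixed_volume_uminus) auto
    finally show "mixed_volume_fun (map (\<lambda>f u. f (- u)) hs) = mixed_volume Ks" .
  next
    fix hs :: "(real^'n \<Rightarrow> real) list" and i and f g :: "real^'n \<Rightarrow> real" and a b :: real
    assume l: "length hs = DIM(real^'n)" "set hs \<subseteq> support_differences" "i < DIM(real^'n)"
      "f \<in> support_differences" "g \<in> support_differences"
    show "mixed_volume_fun (map (\<lambda>f u. f (- u)) (hs[i := (\<lambda>u. a * f u + b * g u)])) =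
      a * mixed_volume_fun (map (\<lambda>f u. f (- u)) (hs[i := f])) + b * mixed_volume_fun (map (\<lambda>f u. f (- u)) (hs[i := g]))"
      unfolding map_update using l support_differences_reflect
      by (intro multilinear_extensionD(2)[OF mixed_volume_fun_extension]) auto
  qed
  from multilinear_extension_unique[OF this mixed_volume_fun_extension, of fs]
  show ?thesis using assms by simp
qed

lemma mixed_volume_fun_linear_head:
  fixes f g :: "real^'n \<Rightarrow> real"
  assumes "length fs + 1 = CARD('n)" "set fs \<subseteq> support_differences" "f \<in> support_differences" "g \<in> support_differences"
  shows "mixed_volume_fun ((\<lambda>u. a * f u + b * g u) # fs) = a * mixed_volume_fun (f # fs) + b * mixed_volume_fun (g # fs)"
  using multilinear_extensionD(2)[OF mixed_volume_fun_extension, of "f # fs" 0 f g a b] assms by simp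

lemma mixed_volume_fun_uminus_replicate:
  fixes f :: "real^'n \<Rightarrow> real"
  assumes "f \<in> support_differences"
  shows "k + length fs = CARD('n) \<Longrightarrow> set fs \<subseteq> support_differences \<Longrightarrow>
    mixed_volume_fun (replicate k (\<lambda>u. - f u) @ fs) = (-1) ^ k * mixed_volume_fun (replicate k f @ fs)"
proof (induction k arbitrary: fs)
  case (Suc k)
  have m: "set (replicate k (\<lambda>u. - f u)) \<subseteq> support_differences" "(\<lambda>u. - f u) \<in> support_differences"
    using support_differences_minus[OF assms] by auto
  have "mixed_volume_fun (replicate (Suc k) (\<lambda>u. - f u) @ fs) = - mixed_volume_fun (f # replicate k (\<lambda>u. - f u) @ fs)"
    \<comment> \<open>Negation is the combination with coefficients \<open>-1\<close> and
      \<open>0\<close>, both applied to \<open>f\<close>.\<close>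
    using mixed_volume_fun_linear_head[of "replicate k (\<lambda>u. - f u) @ fs" f f "-1" 0] Suc.prems assms m by simp
  also have "mixed_volume_fun (f # replicate k (\<lambda>u. - f u) @ fs) = mixed_volume_fun (replicate k (\<lambda>u. - f u) @ f # fs)"
    using Suc.prems assms m by (intro mixed_volume_fun_mset) auto
  also have "\<dots> = (-1) ^ k * mixed_volume_fun (replicate k f @ f # fs)"
    using Suc.prems assms by (intro Suc.IH) auto
  also have "mixed_volume_fun (replicate k f @ f # fs) = mixed_volume_fun (replicate (Suc k) f @ fs)"
    using Suc.prems assms by (intro mixed_volume_fun_mset) auto
  finally show ?case by simp
qed simp

section \<open>Quermassintegrals along the reflection path\<close>

lemma even_odd_part_differences:
  assumes "convex_body K"
  shows "even_part (support_fun K) \<in> support_differences" "odd_part (support_fun K) \<in> support_differences"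
proof -
  have hK: "support_fun K \<in> support_differences"
    using assms by (intro is_support_fun_imp_difference[of _ K]) (simp add: is_support_fun_def)
  show "even_part (support_fun K) \<in> support_differences" "odd_part (support_fun K) \<in> support_differences"
    using support_differences_combination[OF hK support_differences_reflect[OF hK], of "1/2" "1/2"]
      support_differences_combination[OF hK support_differences_reflect[OF hK], of "1/2" "-1/2"]
    by (simp_all add: even_part_def[abs_def] odd_part_def[abs_def] add_divide_distrib diff_divide_distrib)
qed

lemma is_support_fun_one: "is_support_fun (\<lambda>_. 1) (cball 0 1)"
  by (simp add: is_support_fun_def convex_body_cball support_fun_cball)

text \<open>The range of \<open>t\<close> keeps both dilation factors nonnegative, as
  \<open>support_fun_scaleR\<close> demands.\<close>

lemma support_fun_reflection_path:
  fixes K :: "'a::euclidean_space set"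
  assumes "convex_body K" "t \<in> {-1..1}"
  shows "support_fun (reflection_path K t) u = even_part (support_fun K) u + t * odd_part (support_fun K) u"
proof -
  note K = convex_bodyD[OF assms(1)]
  have "support_fun (reflection_path K t) u = (1 + t) / 2 * support_fun K u + (1 - t) / 2 * support_fun K (- u)"
    unfolding reflection_path_def using K assms(2)
    by (simp add: support_fun_plus support_fun_scaleR support_fun_uminus compact_scaling compact_negations)
  then show ?thesis by (simp add: even_part_def odd_part_def field_simps)
qed

lemma convex_body_reflection_path:
  fixes K :: "'a::euclidean_space set"
  assumes "convex_body K" "t \<in> {-1..1}"
  shows "convex_body (reflection_path K t)"
proof -
  have u: "convex_body (uminus ` K)" using assms(1) by (rule convex_body_uminus)
  have c: "compact ((*\<^sub>R) s ` A)" "convex ((*\<^sub>R) s ` A)" "(*\<^sub>R) s ` A \<noteq> {}" if "convex_body A" for A :: "'a set" and s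
    using convex_bodyD[OF that] by (auto intro: compact_scaling convex_scaling)
  \<comment> \<open>At the end points one dilate is a point, but one of the two factors is always
    positive.\<close>
  consider "1 + t > 0" | "1 - t > 0" by linarith
  then show ?thesis
  proof cases
    case 1
    then show ?thesis
      unfolding reflection_path_def by (intro convex_body_plus convex_body_scaleR assms c u) auto
  next
    case 2
    then show ?thesis
      unfolding reflection_path_def by (subst add.commute) (intro convex_body_plus convex_body_scaleR assms c u; simp)
  qed
qed

lemma reflection_path_0:
  fixes K :: "'a::euclidean_space set"
  shows "reflection_path K 0 = central_symmetral K"
proof -
  have "(*\<^sub>R) c ` (A + B) = (*\<^sub>R) c ` A + (*\<^sub>R) c ` B" for c and A B :: "'a set"
  proof
    show "(*\<^sub>R) c ` A + (*\<^sub>R) c ` B \<subseteq> (*\<^sub>R) c ` (A + B)"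
      by (auto elim!: set_plus_elim simp flip: scaleR_add_right intro!: imageI set_plus_intro)
  qed (auto elim!: set_plus_elim simp: scaleR_add_right intro!: set_plus_intro)
  then show ?thesis by (simp add: reflection_path_def central_symmetral_def)
qed

lemma reflection_path_1:
  fixes K :: "'a::euclidean_space set"
  assumes "K \<noteq> {}"
  shows "reflection_path K 1 = K"
proof -
  have "(*\<^sub>R) 0 ` uminus ` K = {0}" using assms by auto
  then show ?thesis by (simp add: reflection_path_def flip: set_zero)
qed

lemma quermassintegral_reflection_path:
  fixes K :: "(real^'n) set"
  assumes K: "convex_body K" and t: "t \<in> {-1..1}" and k: "k \<le> CARD('n)"
  shows "quermassintegral (CARD('n) - k) (reflection_path K t) =
    (\<Sum>j\<le>k. real (k choose j) * t ^ j * mixed_volume_fun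
      (replicate (k - j) (even_part (support_fun K)) @ replicate j (odd_part (support_fun K)) @
       replicate (CARD('n) - k) (\<lambda>_. 1)))"
proof -
  let ?e = "even_part (support_fun K)" and ?o = "odd_part (support_fun K)"
  \<comment> \<open>The factor 1 gives the form \<open>a * f u + b * g u\<close> of
    \<open>mixed_volume_fun_linear_head\<close>.\<close>
  let ?h = "\<lambda>u. 1 * ?e u + t * ?o u"
  let ?one = "\<lambda>_ :: real^'n. 1 :: real"
  have h: "is_support_fun ?h (reflection_path K t)"
    using convex_body_reflection_path[OF K t] support_fun_reflection_path[OF K t] by (simp add: is_support_fun_def)
  note one = is_support_fun_one[where 'a="real^'n"]
  note eo = even_odd_part_differences[OF K]
  note sd = eo h[THEN is_support_fun_imp_difference] one[THEN is_support_fun_imp_difference]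
  have "quermassintegral (CARD('n) - k) (reflection_path K t) =
      mixed_volume (replicate k (reflection_path K t) @ replicate (CARD('n) - k) (cball 0 1))"
    using k by (simp add: quermassintegral_def)
  also have "\<dots> = mixed_volume_fun (replicate k ?h @ replicate (CARD('n) - k) ?one)"
  proof (rule multilinear_extensionD(1)[OF mixed_volume_fun_extension, symmetric])
    show "list_all2 is_support_fun (replicate k ?h @ replicate (CARD('n) - k) ?one)
        (replicate k (reflection_path K t) @ replicate (CARD('n) - k) (cball 0 1))"
      using h one by (intro list_all2_appendI) (simp_all add: list_all2_conv_all_nth)
  qed (use k in simp)
  also have "\<dots> = (\<Sum>j\<le>k. real (k choose j) * t ^ j * mixed_volume_fun
      (replicate (k - j) ?e @ replicate j ?o @ replicate (CARD('n) - k) ?one))"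
  proof (rule binomial_multilinear[where D=support_differences and n="CARD('n)"])
    show "mixed_volume_fun (?h # xs) = mixed_volume_fun (?e # xs) + t * mixed_volume_fun (?o # xs)"
      if "set xs \<subseteq> support_differences" "length xs + 1 = CARD('n)" for xs
      using mixed_volume_fun_linear_head[OF that(2,1) eo, of 1 t] by simp
    show "mixed_volume_fun xs = mixed_volume_fun ys"
      if "set xs \<subseteq> support_differences" "length xs = CARD('n)" "mset xs = mset ys" for xs ys :: "(real^'n \<Rightarrow> real) list"
      using mixed_volume_fun_mset that by blast
  qed (use sd k in auto)
  finally show ?thesis .
qed

text \<open>Reflecting all arguments fixes the even part and the constant 1 and negates the odd
  part, so the value equals \<open>(-1) ^ j\<close> times itself.\<close>

lemma mixed_volume_fun_odd_part_vanishes: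
  fixes K :: "(real^'n) set"
  assumes K: "convex_body K" and j: "j \<le> k" "k \<le> CARD('n)" "odd j"
  shows "mixed_volume_fun
      (replicate (k - j) (even_part (support_fun K)) @ replicate j (odd_part (support_fun K)) @
       replicate (CARD('n) - k) (\<lambda>_. 1)) = 0"
proof -
  let ?e = "even_part (support_fun K)" and ?o = "odd_part (support_fun K)"
  let ?one = "\<lambda>_ :: real^'n. 1 :: real"
  let ?fs = "replicate (k - j) ?e @ replicate j ?o @ replicate (CARD('n) - k) ?one"
  let ?rest = "replicate (k - j) ?e @ replicate (CARD('n) - k) ?one"
  note eo = even_odd_part_differences[OF K]
  note one = is_support_fun_one[where 'a="real^'n", THEN is_support_fun_imp_difference]
  have neg: "(\<lambda>u. - ?o u) \<in> support_differences" using eo(2) by (rule support_differences_minus)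
  have "mixed_volume_fun ?fs = mixed_volume_fun (map (\<lambda>f u. f (- u)) ?fs)"
    using eo one j by (intro mixed_volume_fun_reflect[symmetric]) auto
  also have "map (\<lambda>f u. f (- u)) ?fs =
      replicate (k - j) ?e @ replicate j (\<lambda>u. - ?o u) @ replicate (CARD('n) - k) ?one"
    by (simp add: even_part_def[abs_def] odd_part_def[abs_def] add.commute) (simp add: fun_eq_iff field_simps)
  also have "mixed_volume_fun \<dots> = mixed_volume_fun (replicate j (\<lambda>u. - ?o u) @ ?rest)"
    using eo one neg j by (intro mixed_volume_fun_mset) auto
  also have "\<dots> = (-1) ^ j * mixed_volume_fun (replicate j ?o @ ?rest)"
    using eo one j by (intro mixed_volume_fun_uminus_replicate) auto
  also have "mixed_volume_fun (replicate j ?o @ ?rest) = mixed_volume_fun ?fs"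
    using eo one j by (intro mixed_volume_fun_mset) auto
  finally show ?thesis using j(3) by simp
qed

lemma sum_even_index:
  fixes a :: "nat \<Rightarrow> real"
  assumes "\<And>j. j \<le> k \<Longrightarrow> odd j \<Longrightarrow> a j = 0"
  shows "(\<Sum>j\<le>k. a j) = a 0 + (\<Sum>r = 1..k div 2. a (2 * r))"
proof -
  have "(\<Sum>j\<le>k. a j) = (\<Sum>j\<in>(\<lambda>r. 2 * r) ` {0..k div 2}. a j)"
  proof (rule sum.mono_neutral_right)
    show "\<forall>i\<in>{..k} - (\<lambda>r. 2 * r) ` {0..k div 2}. a i = 0"
    proof
      fix i assume i: "i \<in> {..k} - (\<lambda>r. 2 * r) ` {0..k div 2}"
      have "odd i"
      proof
        assume "even i"
        then have "i = 2 * (i div 2)" "i div 2 \<in> {0..k div 2}" using i by (auto intro: div_le_mono)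
        then show False using i by blast
      qed
      then show "a i = 0" using assms i by auto
    qed
  qed auto
  also have "\<dots> = (\<Sum>r\<in>{0..k div 2}. a (2 * r))"
    by (subst sum.reindex) (auto simp: inj_on_def)
  also have "\<dots> = a 0 + (\<Sum>r = 1..k div 2. a (2 * r))"
    by (simp add: sum.atLeast_Suc_atMost)
  finally show ?thesis .
qed

lemma quermassintegral_reflection_path_even:
  fixes K :: "(real^'n) set"
  assumes K: "convex_body K" and t: "t \<in> {-1..1}" and k: "k \<le> CARD('n)"
  shows "quermassintegral (CARD('n) - k) (reflection_path K t) =
    quermassintegral (CARD('n) - k) (central_symmetral K) +
    (\<Sum>r = 1..k div 2. real (k choose (2 * r)) * t ^ (2 * r) * mixed_volume_fun
      (replicate (k - 2 * r) (even_part (support_fun K)) @ replicate (2 * r) (odd_part (support_fun K)) @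
       replicate (CARD('n) - k) (\<lambda>_. 1)))"
proof -
  define a where "a s j = real (k choose j) * s ^ j * mixed_volume_fun
      (replicate (k - j) (even_part (support_fun K)) @ replicate j (odd_part (support_fun K)) @
       replicate (CARD('n) - k) (\<lambda>_. 1))" for s :: real and j
  have W: "quermassintegral (CARD('n) - k) (reflection_path K s) = a s 0 + (\<Sum>r = 1..k div 2. a s (2 * r))"
    if "s \<in> {-1..1}" for s
  proof -
    have "quermassintegral (CARD('n) - k) (reflection_path K s) = (\<Sum>j\<le>k. a s j)"
      unfolding a_def using K that k by (rule quermassintegral_reflection_path)
    also have "\<dots> = a s 0 + (\<Sum>r = 1..k div 2. a s (2 * r))"
      unfolding a_def using mixed_volume_fun_odd_part_vanishes[OF K _ k] by (intro sum_even_index) simp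
    finally show ?thesis .
  qed
  \<comment> \<open>At parameter 0 all terms of positive degree vanish, which identifies the
    constant term of the expansion.\<close>
  have "quermassintegral (CARD('n) - k) (central_symmetral K) = a 0 0"
    using W[of 0] reflection_path_0[of K] by (simp add: a_def power_0_left)
  moreover have "a t 0 = a 0 0" by (simp add: a_def)
  ultimately show ?thesis using W[OF t] unfolding a_def by simp
qed

theorem theorem3p2:
  fixes K :: "(real ^ 'n) set"
  assumes "convex_body K"
  shows "(\<forall>t\<in>{-1..1}. \<forall>k\<in>{1..CARD('n)}.
            quermassintegral (CARD('n) - k) (reflection_path K t) =
              quermassintegral (CARD('n) - k) (central_symmetral K) +
              (\<Sum>r = 1..k div 2. real (k choose (2 * r)) * t ^ (2 * r) *
                 mixed_volume_fun
                   (replicate (k - 2 * r) (even_part (support_fun K)) @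
                    replicate (2 * r) (odd_part (support_fun K)) @
                    replicate (CARD('n) - k) (\<lambda>_. 1)))) \<and>
         (\<forall>k\<in>{1..CARD('n)}.
            asymmetry k K =
              - (\<Sum>r = 1..k div 2. real (k choose (2 * r)) *
                 mixed_volume_fun
                   (replicate (k - 2 * r) (even_part (support_fun K)) @
                    replicate (2 * r) (odd_part (support_fun K)) @
                    replicate (CARD('n) - k) (\<lambda>_. 1))))"
proof (intro conjI ballI)
  fix t :: real and k assume "t \<in> {-1..1}" "k \<in> {1..CARD('n)}"
  then show "quermassintegral (CARD('n) - k) (reflection_path K t) =
              quermassintegral (CARD('n) - k) (central_symmetral K) +
              (\<Sum>r = 1..k div 2. real (k choose (2 * r)) * t ^ (2 * r) *
                 mixed_volume_fun
                   (replicate (k - 2 * r) (even_part (support_fun K)) @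
                    replicate (2 * r) (odd_part (support_fun K)) @
                    replicate (CARD('n) - k) (\<lambda>_. 1)))"
    by (intro quermassintegral_reflection_path_even assms) auto
next
  \<comment> \<open>At \<open>t = 1\<close> the path reaches \<open>K\<close> itself and all powers
    of \<open>t\<close> are 1.\<close>
  fix k assume "k \<in> {1..CARD('n)}"
  then show "asymmetry k K =
              - (\<Sum>r = 1..k div 2. real (k choose (2 * r)) *
                 mixed_volume_fun
                   (replicate (k - 2 * r) (even_part (support_fun K)) @
                    replicate (2 * r) (odd_part (support_fun K)) @
                    replicate (CARD('n) - k) (\<lambda>_. 1)))"
    using quermassintegral_reflection_path_even[OF assms, of 1 k] reflection_path_1[OF convex_body_nonempty[OF assms]]
    by (simp add: asymmetry_def)
qed

end
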